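(* Let $\gamma=\gamma(n)\in[0,\tfrac12]$, and let $\mathcal{P}=\mathcal{P}_n$ (with signal parameter $\gamma(n)$) and $\mathcal{Q}=\mathcal{Q}_n$ be the planted and null models of random tournaments on $n$ vertices. The following hold (asymptotics as $n\to\infty$): 1. If $\gamma=\omega(n^{-3/4})$, then there exists a polynomial-time algorithm that achieves strong detection between $\mathcal{P}$ and $\mathcal{Q}$. 2. If $\gamma=O(n^{-3/4})$, then there exists no algorithm (of any running time) achieving strong detection between $\mathcal{P}$ and $\mathcal{Q}$. 3. There exists a constant $c>0$ such that, if $\gamma\ge c\cdot n^{-3/4}$, then there exists a polynomial-time algorithm that achieves weak detection between $\mathcal{P}$ and $\mathcal{Q}$. 4. If $\gamma=o(n^{-3/4})$, then there exists no algorithm (of any running time) achieving weak detection between $\mathcal{P}$ and $\mathcal{Q}$.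
   Context: A tournament on $n$ vertices is identified with its tournament matrix $T\in\{-1,0,1\}^{n\times n}$, which is skew-symmetric with zero diagonal and off-diagonal entries $T_{i,j}=-T_{j,i}\in\{\pm1\}$; $T_{i,j}=1$ means the edge between $i$ and $j$ is directed from $i$ to $j$. Planted model $\mathcal{P}$ with signal parameter $\gamma\in[0,\frac12]$: draw a hidden permutation $\pi$ uniformly from the symmetric group $S_n$; conditionally on $\pi$, independently for each pair $i,j$ with $\pi(i)<\pi(j)$, set $T_{i,j}=-T_{j,i}=+1$ with probability $\frac12+\gamma$ and $-1$ with probability $\frac12-\gamma$. Null model $\mathcal{Q}$: the case $\gamma=0$, i.e. $T$ is a uniformly random tournament. An algorithm $A$ taking as input a tournament $T$ on $n$ vertices and outputting an element of $\{0,1\}$ achieves weak detection between $\mathcal{P}$ and $\mathcal{Q}$ if there is a constant $\delta>0$ with $$\limsup_{n\to\infty}\left(\Pr_{T\sim\mathcal{Q}}[A(T)=1]+\Pr_{T\sim\mathcal{P}}[A(T)=0]\right)\le 1-\delta,$$ and achieves strong detection if $$\lim_{n\to\infty}\left(\Pr_{T\sim\mathcal{Q}}[A(T)=1]+\Pr_{T\sim\mathcal{P}}[A(T)=0]\right)=0.$$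
   Formalization: In part 1 the polynomial-time algorithm receives, besides the tournament, γ(n) truncated to n binary digits; for one fixed program given only the tournament, part 1 fails for some γ=ω(n^{-3/4}) growing slowly enough, by diagonalizing over the countably many programs. *)

theory Defs
  imports "HOL-Probability.Probability" "HOL-Library.Landau_Symbols"
begin

section \<open>Tournaments and the two models\<close>

text \<open>The vertices are \<open>0, \<dots>, n - 1\<close>.  A tournament matrix is extended by \<open>0\<close> outside
  \<open>{..<n} \<times> {..<n}\<close>, so that it is determined by its entries.\<close>

type_synonym tmatrix = "nat \<Rightarrow> nat \<Rightarrow> int"

definition tournament :: "nat \<Rightarrow> tmatrix \<Rightarrow> bool" where
  "tournament n T \<longleftrightarrow>
     (\<forall>i<n. \<forall>j<n. T i j = - T j i \<and> (i \<noteq> j \<longrightarrow> T i j \<in> {1, -1})) \<and>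
     (\<forall>i j. \<not> (i < n \<and> j < n) \<longrightarrow> T i j = 0)"

text \<open>The pairs \<open>(i, j)\<close> in which \<open>\<pi>\<close> ranks \<open>i\<close> before \<open>j\<close>; there is exactly one such ordered
  pair for every pair of distinct vertices.\<close>

definition ranked_pairs :: "nat \<Rightarrow> (nat \<Rightarrow> nat) \<Rightarrow> (nat \<times> nat) set" where
  "ranked_pairs n \<pi> = {(i, j). i < n \<and> j < n \<and> \<pi> i < \<pi> j}"

text \<open>The tournament in which the edge of the ranked pair \<open>(i, j)\<close> agrees with the ranking \<open>\<pi>\<close>
  iff \<open>X (i, j)\<close>.\<close>

definition orient :: "nat \<Rightarrow> (nat \<Rightarrow> nat) \<Rightarrow> (nat \<times> nat \<Rightarrow> bool) \<Rightarrow> tmatrix" where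
  "orient n \<pi> X = (\<lambda>i j.
     if (i, j) \<in> ranked_pairs n \<pi> then (if X (i, j) then 1 else -1)
     else if (j, i) \<in> ranked_pairs n \<pi> then (if X (j, i) then -1 else 1)
     else 0)"

definition planted_given :: "nat \<Rightarrow> real \<Rightarrow> (nat \<Rightarrow> nat) \<Rightarrow> tmatrix pmf" where
  "planted_given n \<gamma> \<pi> =
     map_pmf (orient n \<pi>) (Pi_pmf (ranked_pairs n \<pi>) False (\<lambda>_. bernoulli_pmf (1 / 2 + \<gamma>)))"

definition planted_model :: "nat \<Rightarrow> real \<Rightarrow> tmatrix pmf" where
  "planted_model n \<gamma> =
     bind_pmf (pmf_of_set {\<pi>. \<pi> permutes {..<n}}) (planted_given n \<gamma>)"

definition null_model :: "nat \<Rightarrow> tmatrix pmf" where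
  "null_model n = planted_model n 0"

lemma finite_ranked_pairs: "finite (ranked_pairs n \<pi>)"
  by (rule finite_subset[of _ "{..<n} \<times> {..<n}"]) (auto simp: ranked_pairs_def)

lemma tournament_orient:
  assumes "\<pi> permutes {..<n}"
  shows "tournament n (orient n \<pi> X)"
proof -
  have "i = j" if "\<pi> i = \<pi> j" for i j
    using that permutes_inj[OF assms] by (simp add: inj_eq)
  then show ?thesis
    unfolding tournament_def orient_def ranked_pairs_def by auto
qed

lemma bij_betw_orient:
  assumes "\<pi> permutes {..<n}"
  shows "bij_betw (orient n \<pi>) (PiE_dflt (ranked_pairs n \<pi>) False (\<lambda>_. UNIV))
    {T. tournament n T}"
proof (rule bij_betw_byWitness[where f' = "\<lambda>T (i, j). (i, j) \<in> ranked_pairs n \<pi> \<and> T i j = 1"])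
  have neq: "\<pi> i < \<pi> j \<or> \<pi> j < \<pi> i" if "i \<noteq> j" for i j
    using that permutes_inj[OF assms] by (metis injD nat_neq_iff)
  show "\<forall>X\<in>PiE_dflt (ranked_pairs n \<pi>) False (\<lambda>_. UNIV).
    (\<lambda>(i, j). (i, j) \<in> ranked_pairs n \<pi> \<and> orient n \<pi> X i j = 1) = X"
    by (auto simp: PiE_dflt_def orient_def fun_eq_iff)
  show "\<forall>T\<in>{T. tournament n T}.
    orient n \<pi> (\<lambda>(i, j). (i, j) \<in> ranked_pairs n \<pi> \<and> T i j = 1) = T"
  proof (intro ballI ext)
    fix T i j assume "T \<in> {T. tournament n T}"
    then have T: "tournament n T" by simp
    show "orient n \<pi> (\<lambda>(i, j). (i, j) \<in> ranked_pairs n \<pi> \<and> T i j = 1) i j = T i j"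
    proof (cases "i < n \<and> j < n \<and> i \<noteq> j")
      case True
      then have skew: "T j i = - T i j" and "T i j \<in> {1, -1}"
        using T unfolding tournament_def by blast+
      then consider "T i j = 1" "T j i = -1" | "T i j = -1" "T j i = 1"
        by force
      then show ?thesis
        using True neq[of i j] by cases (auto simp: orient_def ranked_pairs_def)
    next
      case False
      have "T i j = 0"
      proof (cases "i < n \<and> j < n")
        case True
        then have "i = j" using False by simp
        have "T i i = - T i i"
          using T True unfolding tournament_def by blast
        then show ?thesis using \<open>i = j\<close> by simp
      next
        case False
        then show ?thesis using T unfolding tournament_def by blast
      qed
      then show ?thesis using False by (auto simp: orient_def ranked_pairs_def)
    qed
  qed
  show "orient n \<pi> ` PiE_dflt (ranked_pairs n \<pi>) False (\<lambda>_. UNIV) \<subseteq> {T. tournament n T}"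
    using tournament_orient[OF assms] by auto
  show "(\<lambda>T (i, j). (i, j) \<in> ranked_pairs n \<pi> \<and> T i j = 1) ` {T. tournament n T}
    \<subseteq> PiE_dflt (ranked_pairs n \<pi>) False (\<lambda>_. UNIV)"
    by (auto simp: PiE_dflt_def)
qed

lemma null_model_uniform: "null_model n = pmf_of_set {T. tournament n T}"
proof -
  have *: "planted_given n 0 \<pi> = pmf_of_set {T. tournament n T}"
    if "\<pi> permutes {..<n}" for \<pi>
  proof -
    let ?D = "PiE_dflt (ranked_pairs n \<pi>) False (\<lambda>_. UNIV :: bool set)"
    have fin: "finite ?D"
      by (intro finite_PiE_dflt finite_ranked_pairs) auto
    have ne: "?D \<noteq> {}"
      by auto
    have "Pi_pmf (ranked_pairs n \<pi>) False (\<lambda>_. bernoulli_pmf (1 / 2 + 0)) =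
      Pi_pmf (ranked_pairs n \<pi>) False (\<lambda>_. pmf_of_set UNIV)"
      by (simp add: bernoulli_pmf_half_conv_pmf_of_set)
    also have "\<dots> = pmf_of_set ?D"
      by (rule Pi_pmf_of_set) (auto simp: finite_ranked_pairs)
    finally show ?thesis
      unfolding planted_given_def
      by (simp only:) (rule map_pmf_of_set_bij_betw[OF bij_betw_orient[OF that] ne fin])
  qed
  have "null_model n =
    bind_pmf (pmf_of_set {\<pi>. \<pi> permutes {..<n}}) (\<lambda>_. pmf_of_set {T. tournament n T})"
    unfolding null_model_def planted_model_def
  proof (rule bind_pmf_cong[OF refl])
    fix \<pi> assume "\<pi> \<in> set_pmf (pmf_of_set {\<pi>. \<pi> permutes {..<n}})"
    moreover have "{\<pi>. \<pi> permutes {..<n}} \<noteq> {}"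
      using permutes_id by blast
    ultimately have "\<pi> permutes {..<n}"
      by (simp add: finite_permutations)
    then show "planted_given n 0 \<pi> = pmf_of_set {T. tournament n T}"
      by (rule *)
  qed
  then show ?thesis by simp
qed


section \<open>Detection\<close>

text \<open>\<open>A n T\<close> is the law of the output (\<open>True\<close> for 1) on a tournament \<open>T\<close> with \<open>n\<close> vertices.
  Arbitrary, possibly randomized and non-computable, families of tests are allowed here; a
  deterministic algorithm returns point masses.\<close>

type_synonym test = "nat \<Rightarrow> tmatrix \<Rightarrow> bool pmf"

definition detection_error :: "(nat \<Rightarrow> real) \<Rightarrow> test \<Rightarrow> nat \<Rightarrow> real" where
  "detection_error \<gamma> A n =
     pmf (bind_pmf (null_model n) (A n)) True +
     pmf (bind_pmf (planted_model n (\<gamma> n)) (A n)) False"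

definition weak_detection :: "(nat \<Rightarrow> real) \<Rightarrow> test \<Rightarrow> bool" where
  "weak_detection \<gamma> A \<longleftrightarrow>
     (\<exists>\<delta>>0. limsup (\<lambda>n. ereal (detection_error \<gamma> A n)) \<le> ereal (1 - \<delta>))"

definition strong_detection :: "(nat \<Rightarrow> real) \<Rightarrow> test \<Rightarrow> bool" where
  "strong_detection \<gamma> A \<longleftrightarrow> detection_error \<gamma> A \<longlonglongrightarrow> 0"


section \<open>Polynomial-time algorithms\<close>

text \<open>The machine model is a random access machine with registers \<open>R\<close>, which are addressed
  directly, and a memory \<open>M\<close>, which is addressed through registers; every instruction costs
  one unit of time.  The arithmetic is restricted to addition and truncated subtraction.  Hence
  numbers grow by at most one bit per step, and polynomial time with unit costs is the same as
  polynomial time on Turing machines (this would fail with a unit-cost multiplication).\<close>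

datatype instr =
    Const nat nat        \<comment> \<open>\<open>R d := c\<close>\<close>
  | Add nat nat nat      \<comment> \<open>\<open>R d := R r + R s\<close>\<close>
  | Sub nat nat nat      \<comment> \<open>\<open>R d := R r - R s\<close>\<close>
  | Load nat nat         \<comment> \<open>\<open>R d := M (R r)\<close>\<close>
  | Store nat nat        \<comment> \<open>\<open>M (R r) := R s\<close>\<close>
  | JumpZero nat nat     \<comment> \<open>if \<open>R r = 0\<close> go to instruction \<open>l\<close>\<close>

text \<open>program counter, registers, memory\<close>

type_synonym config = "nat \<times> (nat \<Rightarrow> nat) \<times> (nat \<Rightarrow> nat)"

fun exec :: "instr \<Rightarrow> config \<Rightarrow> config" where
  "exec (Const d c) (pc, R, M) = (Suc pc, R(d := c), M)"
| "exec (Add d r s) (pc, R, M) = (Suc pc, R(d := R r + R s), M)"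
| "exec (Sub d r s) (pc, R, M) = (Suc pc, R(d := R r - R s), M)"
| "exec (Load d r) (pc, R, M) = (Suc pc, R(d := M (R r)), M)"
| "exec (Store r s) (pc, R, M) = (Suc pc, R, M(R r := R s))"
| "exec (JumpZero r l) (pc, R, M) = (if R r = 0 then l else Suc pc, R, M)"

text \<open>The machine halts when the program counter leaves the program.\<close>

definition step :: "instr list \<Rightarrow> config \<Rightarrow> config" where
  "step P c = (if fst c < length P then exec (P ! fst c) c else c)"

text \<open>\<open>P\<close> started in \<open>c\<close> halts after at most \<open>t\<close> steps; its output is 1 (\<open>b = True\<close>) iff
  register 0 then contains 1.\<close>

definition halts_with :: "instr list \<Rightarrow> config \<Rightarrow> nat \<Rightarrow> bool \<Rightarrow> bool" where
  "halts_with P c t b \<longleftrightarrow>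
     (case (step P ^^ t) c of (pc, R, M) \<Rightarrow> length P \<le> pc \<and> (b \<longleftrightarrow> R 0 = 1))"

text \<open>The number of vertices is in register 0, the number \<open>w\<close> in register 1, and the memory
  holds the adjacency matrix of the tournament, row by row, as bits.\<close>

definition initial_config :: "nat \<Rightarrow> nat \<Rightarrow> tmatrix \<Rightarrow> config" where
  "initial_config n w T =
     (0, (\<lambda>_. 0)(0 := n, 1 := w),
      (\<lambda>a. if a < n * n \<and> T (a div n) (a mod n) = 1 then 1 else 0))"

text \<open>One fixed program computes \<open>A\<close> on all tournaments of all sizes, in time polynomial in the
  number of vertices.  Besides the tournament, the program is given the number \<open>w n\<close>, which depends
  only on \<open>n\<close>: \<open>w = (\<lambda>_. 0)\<close> for an algorithm whose only input is the tournament, and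
  \<open>w = parameter_digits \<gamma>\<close> for an algorithm that knows the parameter of the model.\<close>

definition polynomial_time_with :: "(nat \<Rightarrow> nat) \<Rightarrow> test \<Rightarrow> bool" where
  "polynomial_time_with w A \<longleftrightarrow>
     (\<exists>P C k. \<forall>n T. tournament n T \<longrightarrow>
        (\<exists>b. halts_with P (initial_config n (w n) T) (C * (n + 1) ^ k) b \<and>
             A n T = return_pmf b))"

abbreviation polynomial_time :: "test \<Rightarrow> bool" where
  "polynomial_time \<equiv> polynomial_time_with (\<lambda>_. 0)"

text \<open>\<open>\<gamma> n\<close> truncated to \<open>n\<close> binary digits after the point, as an integer.  The test for strong
  detection has to know \<open>\<gamma>\<close> in some form: as there are only countably many programs, one can choose
  \<open>\<gamma> n = g n * n powr (- 3 / 4)\<close> with \<open>g\<close> tending to infinity so slowly that no program which is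
  given the tournament alone achieves strong detection.\<close>

definition parameter_digits :: "(nat \<Rightarrow> real) \<Rightarrow> nat \<Rightarrow> nat" where
  "parameter_digits \<gamma> n = nat \<lfloor>\<gamma> n * 2 ^ n\<rfloor>"

end

(* Both directions rest on second moments.

   The test statistic is the wedge sum, the sum of T i j * T i k over i and ordered pairs of distinct
   j, k; up to an affine change it is the sum of the squared outdegrees.  Given the hidden ranking pi,
   write T i j = 2 gamma sigma i j + Z i j with sigma the sign of pi j - pi i and Z centred.  The mean
   4 gamma^2 n (n - 1) (n - 2) / 3 does not depend on pi, and expanding the fluctuation into
   (orthogonal) monomials of degree 1 and 2 in Z bounds the variance by O(n^3 + gamma^2 n^4).
   Chebyshev's inequality then separates the models as soon as gamma^4 n^3 is large.  The threshold
   is n b / 2, where b is the square of an approximation a of n gamma (part 1) or 16 times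
   the integer part of sqrt n (part 3).

   Conversely, the second moment of the likelihood ratio is the average over two rankings of the
   product of 1 + 4 gamma^2 sigma sigma' over all pairs.  Removing the lowest-ranked vertex one at a
   time, with exp t <= t + exp (t^2), bounds it by exp (16 gamma^4 n^3), and the
   Cauchy-Schwarz inequality turns this into a lower bound on the error of every test. *)
theory Submission
  imports Defs "HOL-Library.Discrete_Functions"
begin

section \<open>Timed Hoare triples for the random access machine\<close>

text \<open>The null wedge sum has standard deviation at most of order n^(3/2), and the planted mean
  has order gamma^2 n^3; the two meet at gamma of order n^(-3/4). In part 3 a fixed multiple of
  n^(3/2) can serve as threshold. Part 1 needs a threshold far above n^(3/2) and still below gamma^2
  n^3, however slowly gamma n^(3/4) diverges, so it is computed from gamma. The machine cannot
  multiply or divide: squares, quotients and roots come from loops of additions and subtractions.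

  In the converse, a total variation bound alone says little when gamma^4 n^3 is bounded but large.
  The Cauchy-Schwarz step therefore keeps the null acceptance probability as a factor: it is at most
  the error, so an error tending to 0 is contradictory. The linear term of exp t <= t + exp (t^2) is
  there to cancel: row sums of a skew-symmetric matrix add up to 0. This is why the exponent carries
  gamma^4 and not gamma^2; the squares of the numbers of remaining vertices add up to at most
  n^3.\<close>

type_synonym regs = "nat \<Rightarrow> nat"
text \<open>Jump targets are absolute, so a piece of code is a function of the address at which it
  is placed.\<close>

type_synonym block = "nat \<Rightarrow> instr list"

definition code_at :: "instr list \<Rightarrow> nat \<Rightarrow> instr list \<Rightarrow> bool" where
  "code_at P l xs \<longleftrightarrow> (\<exists>us vs. P = us @ xs @ vs \<and> length us = l)"

lemma code_at_append:
  "code_at P l (xs @ ys) \<longleftrightarrow> code_at P l xs \<and> code_at P (l + length xs) ys"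
proof
  assume "code_at P l (xs @ ys)"
  then obtain us vs where "P = us @ (xs @ ys) @ vs" "length us = l"
    unfolding code_at_def by blast
  then have "P = us @ xs @ (ys @ vs)" "P = (us @ xs) @ ys @ vs" "length us = l"
    "length (us @ xs) = l + length xs"
    by simp_all
  then show "code_at P l xs \<and> code_at P (l + length xs) ys"
    unfolding code_at_def by blast
next
  assume "code_at P l xs \<and> code_at P (l + length xs) ys"
  then obtain us vs us' vs' where *: "P = us @ xs @ vs" "length us = l"
    "P = us' @ ys @ vs'" "length us' = l + length xs"
    unfolding code_at_def by blast
  then have "us' = us @ xs" "vs = ys @ vs'"
    by (metis append_assoc append_eq_append_conv length_append)+
  then show "code_at P l (xs @ ys)"
    using * unfolding code_at_def by auto
qed

lemma code_at_Cons:
  "code_at P l (x # xs) \<longleftrightarrow> l < length P \<and> P ! l = x \<and> code_at P (Suc l) xs"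
proof -
  have "code_at P l [x] \<longleftrightarrow> l < length P \<and> P ! l = x"
    unfolding code_at_def
    by (auto simp: nth_append) (metis append_take_drop_id Cons_nth_drop_Suc length_take min.absorb4)
  then show ?thesis
    using code_at_append[of P l "[x]" xs] by simp
qed

lemma code_at_self: "code_at P 0 P"
  unfolding code_at_def by (intro exI[of _ "[]"]) simp

text \<open>An upper bound on the number of steps, so that time bounds add up under composition and
  can be weakened.\<close>

definition steps :: "instr list \<Rightarrow> config \<Rightarrow> nat \<Rightarrow> config \<Rightarrow> bool" where
  "steps P c t c' \<longleftrightarrow> (\<exists>u\<le>t. (step P ^^ u) c = c')"

lemma steps_refl: "steps P c t c"
  unfolding steps_def by (intro exI[of _ 0]) simp

lemma steps_trans: "steps P c s c' \<Longrightarrow> steps P c' t c'' \<Longrightarrow> steps P c (s + t) c''"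
  unfolding steps_def
proof (elim exE conjE)
  fix u v assume "u \<le> s" "(step P ^^ u) c = c'" "v \<le> t" "(step P ^^ v) c' = c''"
  then show "\<exists>u\<le>s + t. (step P ^^ u) c = c''"
    by (intro exI[of _ "v + u"]) (simp add: funpow_add)
qed

lemma steps_step:
  assumes "l < length P" "P ! l = i" "steps P (exec i (l, R, M)) t c"
  shows "steps P (l, R, M) (Suc t) c"
proof -
  have "steps P (l, R, M) 1 (exec i (l, R, M))"
    unfolding steps_def using assms by (intro exI[of _ 1]) (simp add: step_def)
  from steps_trans[OF this assms(3)] show ?thesis by simp
qed

text \<open>Total correctness with a time bound: the block must reach its own end within
  \<open>t\<close> steps. Quantifying over the surrounding program and the address makes blocks
  composable and keeps the program counter out of the assertions.\<close>

definition triple :: "(regs \<Rightarrow> regs \<Rightarrow> bool) \<Rightarrow> block \<Rightarrow> nat \<Rightarrow> (regs \<Rightarrow> regs \<Rightarrow> bool) \<Rightarrow> bool" where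
  "triple A b t B \<longleftrightarrow> (\<forall>P l R M. code_at P l (b l) \<longrightarrow> A R M \<longrightarrow>
     (\<exists>R' M'. steps P (l, R, M) t (l + length (b l), R', M') \<and> B R' M'))"

lemma tripleD:
  assumes "triple A b t B" "code_at P l (b l)" "A R M"
  obtains R' M' where "steps P (l, R, M) t (l + length (b l), R', M')" "B R' M'"
  using assms unfolding triple_def by blast

definition seq :: "block \<Rightarrow> block \<Rightarrow> block" (infixr ";;" 60) where
  "(b ;; c) = (\<lambda>l. b l @ c (l + length (b l)))"

lemma triple_seq:
  assumes "triple A b s B" "triple B c t C"
  shows "triple A (b ;; c) (s + t) C"
  unfolding triple_def
proof (intro allI impI)
  fix P l R M assume code: "code_at P l ((b ;; c) l)" and A: "A R M"
  obtain R' M' where 1: "steps P (l, R, M) s (l + length (b l), R', M')" "B R' M'"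
    using assms(1) code A by (auto simp: seq_def code_at_append elim: tripleD)
  obtain R'' M'' where
    2: "steps P (l + length (b l), R', M') t (l + length (b l) + length (c (l + length (b l))), R'', M'')"
      "C R'' M''"
    using assms(2) code 1(2) by (auto simp: seq_def code_at_append elim: tripleD)
  from steps_trans[OF 1(1) 2(1)] 2(2)
  show "\<exists>R' M'. steps P (l, R, M) (s + t) (l + length ((b ;; c) l), R', M') \<and> C R' M'"
    by (auto simp: seq_def add.assoc)
qed

lemma triple_conseq:
  assumes "triple A b s B" "\<And>R M. A' R M \<Longrightarrow> A R M" "\<And>R M. B R M \<Longrightarrow> B' R M" "s \<le> t"
  shows "triple A' b t B'"
  unfolding triple_def
proof (intro allI impI)
  fix P l R M assume "code_at P l (b l)" "A' R M"
  then obtain R' M' where "steps P (l, R, M) s (l + length (b l), R', M')" "B R' M'"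
    using assms(1,2) by (metis tripleD)
  then show "\<exists>R' M'. steps P (l, R, M) t (l + length (b l), R', M') \<and> B' R' M'"
    using assms(3,4) unfolding steps_def by (meson le_trans)
qed

text \<open>Serves for conditionals, which are loops of zero or one round: each outcome of the
  comparison gets its own triple.\<close>

lemma triple_cases:
  assumes "triple (\<lambda>R M. A R M \<and> C R M) b t B" "triple (\<lambda>R M. A R M \<and> \<not> C R M) b t B"
  shows "triple A b t B"
  using assms unfolding triple_def by blast

fun straight :: "instr \<Rightarrow> bool" where
  "straight (JumpZero r l) = False"
| "straight _ = True"

text \<open>The effect of a jump-free instruction on registers and memory is independent of the
  program counter, so code can be evaluated by simplification with the dummy counter 0.\<close>

fun execs :: "instr list \<Rightarrow> regs \<times> regs \<Rightarrow> regs \<times> regs" where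
  "execs [] s = s"
| "execs (i # is) s = execs is (snd (exec i (0, s)))"

lemma exec_straight: "straight i \<Longrightarrow> exec i (l, R, M) = (Suc l, snd (exec i (0, R, M)))"
  by (cases i) auto

lemma triple_straight:
  assumes "list_all straight is"
    "\<And>R M. A R M \<Longrightarrow> (case execs is (R, M) of (R', M') \<Rightarrow> B R' M')"
  shows "triple A (\<lambda>_. is) (length is) B"
proof -
  have *: "steps P (l, s) (length is) (l + length is, execs is s)"
    if "code_at P l is" for P l and s :: "regs \<times> regs"
    using that assms(1)
  proof (induction "is" arbitrary: l s)
    case Nil
    then show ?case by (simp add: steps_refl)
  next
    case (Cons i "is")
    have "steps P (Suc l, snd (exec i (0, s))) (length is)
        (l + length (i # is), execs (i # is) s)"
      using Cons.IH[of "Suc l" "snd (exec i (0, s))"] Cons.prems by (simp add: code_at_Cons)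
    then have "steps P (exec i (l, fst s, snd s)) (length is)
        (l + length (i # is), execs (i # is) s)"
      using exec_straight[of i l "fst s" "snd s"] Cons.prems by simp
    then show ?case
      using steps_step[of l P i "fst s" "snd s"] Cons.prems by (simp add: code_at_Cons)
  qed
  show ?thesis
    unfolding triple_def
  proof (intro allI impI)
    fix P l R M assume "code_at P l is" "A R M"
    then show "\<exists>R' M'. steps P (l, R, M) (length is) (l + length is, R', M') \<and> B R' M'"
      using *[of P l "(R, M)"] assms(2)[of R M] by (metis (lifting) case_prod_beta prod.collapse)
  qed
qed

text \<open>Repeats \<open>b\<close> as often as the initial value of register \<open>r\<close> says; register 2 serves as
  scratch space for the constants 1 and 0.\<close>

definition loop :: "nat \<Rightarrow> block \<Rightarrow> block" where
  "loop r b = (\<lambda>l. JumpZero r (l + 5 + length (b (Suc l))) # b (Suc l) @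
     [Const 2 1, Sub r r 2, Const 2 0, JumpZero 2 l])"

text \<open>After each round the loop overwrites the counter \<open>r\<close> and register 2, hence
  \<open>stable\<close>; the body must preserve the counter. A round costs the body, the test at the
  top and the four instructions at the bottom; the final 1 is the test that leaves the loop.\<close>

lemma triple_loop:
  assumes r: "r \<noteq> 2"
    and body: "\<And>k. k < N \<Longrightarrow> triple (\<lambda>R M. J k R M \<and> R r = N - k) b t
      (\<lambda>R M. J (Suc k) R M \<and> R r = N - k)"
    and stable: "\<And>k R M x y. J k R M \<Longrightarrow> J k (R(2 := x, r := y)) M"
  shows "triple (\<lambda>R M. J 0 R M \<and> R r = N) (loop r b) (N * (t + 5) + 1) (J N)"
  unfolding triple_def
proof (intro allI impI)
  fix P l R M
  let ?e = "l + length (loop r b l)"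
  assume code: "code_at P l (loop r b l)" and J: "J 0 R M \<and> R r = N"
  have *: "\<exists>R' M'. steps P (l, R, M) (m * (t + 5) + 1) (?e, R', M') \<and> J N R' M'"
    if "m \<le> N" "J (N - m) R M" "R r = m" for m R M
    using that
  proof (induction m arbitrary: R M)
    case 0
    have "steps P (l, R, M) (Suc 0) (?e, R, M)"
      by (rule steps_step[where i = "JumpZero r ?e"])
        (use code 0 in \<open>auto simp: loop_def code_at_Cons steps_refl add_ac\<close>)
    then show ?case using 0 by auto
  next
    case (Suc m)
    let ?k = "N - Suc m" and ?b = "b (Suc l)"
    have k: "?k < N" "Suc ?k = N - m" "N - ?k = Suc m" using Suc.prems by auto
    have cb: "code_at P (Suc l) ?b"
      and ct: "code_at P (Suc l + length ?b) [Const 2 1, Sub r r 2, Const 2 0, JumpZero 2 l]"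
      and c0: "l < length P" "P ! l = JumpZero r ?e"
      using code by (simp_all add: loop_def code_at_Cons code_at_append add_ac)
    obtain R1 M1 where 1: "steps P (Suc l, R, M) t (Suc l + length ?b, R1, M1)"
        "J (N - m) R1 M1 \<and> R1 r = Suc m"
      using body[OF k(1)] cb Suc.prems(2,3) by (auto simp: k elim: tripleD)
    let ?R = "R1(2 := 0, r := m)"
    have J2: "J (N - m) ?R M1" using 1(2) by (intro stable) auto
    \<comment> \<open>The counter is decremented with the constant 1 in register 2; afterwards
      register 2 is 0, which makes the closing \<open>JumpZero\<close> unconditional.\<close>
    have tail: "steps P (Suc l + length ?b, R1, M1) (Suc (Suc (Suc (Suc 0)))) (l, ?R, M1)"
      using ct r 1(2) unfolding code_at_Cons
      apply (elim conjE)
      apply (rule steps_step, assumption, assumption, simp only: exec.simps)+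
      apply (simp add: steps_refl fun_upd_twist)
      done
    have "m \<le> N" "?R r = m" using Suc.prems by simp_all
    from Suc.IH[OF this(1) J2 this(2)]
    obtain R' M' where 3: "steps P (l, ?R, M1) (m * (t + 5) + 1) (?e, R', M')" "J N R' M'"
      by blast
    have "steps P (Suc l, R, M) (t + (Suc (Suc (Suc (Suc 0))) + (m * (t + 5) + 1))) (?e, R', M')"
      by (intro steps_trans[OF 1(1)] steps_trans[OF tail] 3(1))
    then have "steps P (l, R, M) (Suc (t + (Suc (Suc (Suc (Suc 0))) + (m * (t + 5) + 1)))) (?e, R', M')"
      by (intro steps_step[OF c0]) (use Suc.prems in simp)
    moreover have "Suc (t + (Suc (Suc (Suc (Suc 0))) + (m * (t + 5) + 1))) = Suc m * (t + 5) + 1"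
      by simp
    ultimately show ?case using 3(2) by metis
  qed
  show "\<exists>R' M'. steps P (l, R, M) (N * (t + 5) + 1) (?e, R', M') \<and> J N R' M'"
    using *[of N R M] J by simp
qed

text \<open>A halted configuration is a fixed point of \<open>step\<close>, so running on until the
  time bound changes nothing.\<close>

lemma steps_halts_with:
  assumes "steps P c t (pc, R, M)" "length P \<le> pc" "t \<le> t'"
  shows "halts_with P c t' (R 0 = 1)"
proof -
  obtain u where u: "u \<le> t" "(step P ^^ u) c = (pc, R, M)"
    using assms(1) unfolding steps_def by blast
  have "(step P ^^ v) (pc, R, M) = (pc, R, M)" for v
    by (induction v) (use assms(2) in \<open>auto simp: step_def\<close>)
  from this[of "t' - u"] have "(step P ^^ t') c = (pc, R, M)"
    using u assms(3) by (metis funpow_add le_add_diff_inverse2 le_trans o_apply)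
  then show ?thesis using assms(2) unfolding halts_with_def by simp
qed

lemma triple_code:
  assumes "list_all straight is" "length is \<le> t"
    "\<And>R M. A R M \<Longrightarrow> (case execs is (R, M) of (R', M') \<Rightarrow> B R' M')"
  shows "triple A (\<lambda>_. is) t B"
  by (rule triple_conseq[OF triple_straight[of "is" A B]]) (use assms in auto)

text \<open>Register 3 holds 0, so the addition copies \<open>s\<close> into the counter
  \<open>r\<close>; counting down in \<open>r\<close> spares the bound in \<open>s\<close>.\<close>

definition for_loop :: "nat \<Rightarrow> nat \<Rightarrow> block \<Rightarrow> block" where
  "for_loop r s b = (\<lambda>_. [Add r s 3]) ;; loop r b"

lemma triple_for_loop:
  assumes r: "r \<noteq> 2"
    and body: "\<And>k. k < N \<Longrightarrow> triple (\<lambda>R M. J k R M \<and> R r = N - k) b t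
      (\<lambda>R M. J (Suc k) R M \<and> R r = N - k)"
    and stable: "\<And>k R M x y. J k R M \<Longrightarrow> J k (R(2 := x, r := y)) M"
  shows "triple (\<lambda>R M. J 0 R M \<and> R s = N \<and> R 3 = 0) (for_loop r s b) (N * (t + 5) + 2) (J N)"
proof -
  have "triple (\<lambda>R M. J 0 R M \<and> R s = N \<and> R 3 = 0) (\<lambda>_. [Add r s 3]) 1
      (\<lambda>R M. J 0 R M \<and> R r = N)"
  proof (rule triple_code)
    fix R M assume *: "J 0 R M \<and> R s = N \<and> R 3 = 0"
    then have "J 0 (R(2 := R 2, r := N)) M" using stable by blast
    then show "case execs [Add r s 3] (R, M) of (R', M') \<Rightarrow> J 0 R' M' \<and> R' r = N"
      using * by simp
  qed auto
  from triple_seq[OF this triple_loop[OF r body stable]] show ?thesis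
    unfolding for_loop_def by (rule triple_conseq) auto
qed

text \<open>Register conventions: 3 and 4 hold the constants 0 and 1, and \<open>test_prog\<close> expects the number
  \<open>b\<close> that determines its threshold in register 10.\<close>

definition base :: "nat \<Rightarrow> regs \<Rightarrow> regs \<Rightarrow> regs \<Rightarrow> bool" where
  "base n M0 R M \<longleftrightarrow> R 0 = n \<and> R 3 = 0 \<and> R 4 = 1 \<and> M = M0"

text \<open>Register 8 collects the outdegree as a sum of bits, and its square is formed by adding
  it to register 14 as often as it says. The address in register 13 is not reset, so each row starts
  where the previous one ended.\<close>

definition row_prog :: block where
  "row_prog =
     (\<lambda>_. [Const 8 0]) ;;
     for_loop 11 0 (\<lambda>_. [Load 12 13, Add 8 8 12, Add 13 13 4]) ;;
     for_loop 11 8 (\<lambda>_. [Add 14 14 8])"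

text \<open>Register 16 becomes \<open>n * n\<close>, register 15 collects the left side of the
  comparison and register 14, doubled three times, the right side. The truncated difference is 0 iff
  the comparison holds, and subtracting it from 1 yields the output bit.\<close>

definition test_prog :: block where
  "test_prog =
     (\<lambda>_. [Const 13 0, Const 14 0, Const 15 0, Const 16 0]) ;;
     for_loop 7 0 row_prog ;;
     for_loop 7 0 (\<lambda>_. [Add 15 15 10]) ;;
     for_loop 7 0 (\<lambda>_. [Add 16 16 0]) ;;
     (\<lambda>_. [Sub 17 0 4]) ;;
     for_loop 7 17 (\<lambda>_. [Add 15 15 16, Add 15 15 16]) ;;
     (\<lambda>_. [Add 14 14 14, Add 14 14 14, Add 14 14 14, Sub 15 15 14, Sub 0 4 15])"

lemma triple_row_prog:
  fixes n i :: nat and M0 :: regs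
  defines "d \<equiv> \<Sum>j<n. M0 (i * n + j)"
  assumes "d \<le> n"
  shows "triple
    (\<lambda>R M. base n M0 R M \<and> R 13 = i * n \<and> R 14 = q \<and> R 10 = b \<and> R 15 = 0 \<and> R 16 = 0 \<and> R 7 = x)
    row_prog (14 * n + 5)
    (\<lambda>R M. base n M0 R M \<and> R 13 = Suc i * n \<and> R 14 = q + d\<^sup>2 \<and> R 10 = b \<and> R 15 = 0 \<and>
       R 16 = 0 \<and> R 7 = x)"
proof -
  let ?F = "\<lambda>R M. base n M0 R M \<and> R 10 = b \<and> R 15 = 0 \<and> R 16 = 0 \<and> R 7 = x"
  let ?J = "\<lambda>k R M. ?F R M \<and> R 13 = i * n + k \<and> R 14 = q \<and> R 8 = (\<Sum>j<k. M0 (i * n + j))"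
  let ?K = "\<lambda>k R M. ?F R M \<and> R 13 = Suc i * n \<and> R 14 = q + k * d \<and> R 8 = d"
  have 1: "triple (\<lambda>R M. ?F R M \<and> R 13 = i * n \<and> R 14 = q) (\<lambda>_. [Const 8 0]) 1
      (\<lambda>R M. ?J 0 R M \<and> R 0 = n \<and> R 3 = 0)"
    by (rule triple_code) (auto simp: base_def)
  have 2: "triple (\<lambda>R M. ?J 0 R M \<and> R 0 = n \<and> R 3 = 0)
      (for_loop 11 0 (\<lambda>_. [Load 12 13, Add 8 8 12, Add 13 13 4])) (n * (3 + 5) + 2) (?J n)"
    by (rule triple_for_loop, simp, rule triple_code) (auto simp: base_def)
  have 3: "triple (\<lambda>R M. ?K 0 R M \<and> R 8 = d \<and> R 3 = 0)
      (for_loop 11 8 (\<lambda>_. [Add 14 14 8])) (d * (1 + 5) + 2) (?K d)"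
    by (rule triple_for_loop, simp, rule triple_code) (auto simp: base_def)
  have two: "triple (\<lambda>R M. ?J 0 R M \<and> R 0 = n \<and> R 3 = 0)
      (for_loop 11 0 (\<lambda>_. [Load 12 13, Add 8 8 12, Add 13 13 4])) (n * (3 + 5) + 2)
      (\<lambda>R M. ?K 0 R M \<and> R 8 = d \<and> R 3 = 0)"
    by (rule triple_conseq[OF 2]) (auto simp: base_def d_def)
  show ?thesis
    unfolding row_prog_def
    by (rule triple_conseq[OF triple_seq[OF 1 triple_seq[OF two 3]]])
      (use assms(2) in \<open>auto simp: power2_eq_square\<close>)
qed

lemma triple_test_prog:
  fixes n :: nat and M0 :: regs
  defines "d \<equiv> \<lambda>i. \<Sum>j<n. M0 (i * n + j)"
  assumes d: "\<And>i. i < n \<Longrightarrow> d i \<le> n"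
  shows "triple (\<lambda>R M. base n M0 R M \<and> R 10 = b) test_prog (14 * n\<^sup>2 + 29 * n + 18)
    (\<lambda>R M. R 0 = 1 \<longleftrightarrow> n * b + 2 * (n - 1) * n\<^sup>2 \<le> 8 * (\<Sum>i<n. (d i)\<^sup>2))"
proof -
  let ?q = "\<Sum>i<n. (d i)\<^sup>2"
  let ?J1 = "\<lambda>k R M. base n M0 R M \<and> R 13 = k * n \<and> R 14 = (\<Sum>i<k. (d i)\<^sup>2) \<and> R 10 = b \<and>
    R 15 = 0 \<and> R 16 = 0"
  let ?J2 = "\<lambda>k R M. base n M0 R M \<and> R 10 = b \<and> R 14 = ?q \<and> R 15 = k * b \<and> R 16 = 0"
  let ?J3 = "\<lambda>k R M. base n M0 R M \<and> R 14 = ?q \<and> R 15 = n * b \<and> R 16 = k * n"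
  let ?J4 = "\<lambda>k R M. base n M0 R M \<and> R 14 = ?q \<and> R 15 = n * b + 2 * k * n\<^sup>2 \<and> R 16 = n\<^sup>2"
  have 0: "triple (\<lambda>R M. base n M0 R M \<and> R 10 = b)
      (\<lambda>_. [Const 13 0, Const 14 0, Const 15 0, Const 16 0]) 4 (\<lambda>R M. ?J1 0 R M \<and> R 0 = n \<and> R 3 = 0)"
    by (rule triple_code) (auto simp: base_def)
  have 1: "triple (\<lambda>R M. ?J1 0 R M \<and> R 0 = n \<and> R 3 = 0) (for_loop 7 0 row_prog)
      (n * (14 * n + 5 + 5) + 2) (?J1 n)"
  proof (rule triple_for_loop)
    fix k assume "k < n"
    then have "(\<Sum>j<n. M0 (k * n + j)) \<le> n" using d d_def by simp
    from triple_row_prog[OF this]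
    show "triple (\<lambda>R M. ?J1 k R M \<and> R 7 = n - k) row_prog (14 * n + 5)
        (\<lambda>R M. ?J1 (Suc k) R M \<and> R 7 = n - k)"
      by (rule triple_conseq) (auto simp: d_def)
  qed (auto simp: base_def)
  have 2: "triple (\<lambda>R M. ?J2 0 R M \<and> R 0 = n \<and> R 3 = 0) (for_loop 7 0 (\<lambda>_. [Add 15 15 10]))
      (n * (1 + 5) + 2) (?J2 n)"
    by (rule triple_for_loop, simp, rule triple_code) (auto simp: base_def)
  have 3: "triple (\<lambda>R M. ?J3 0 R M \<and> R 0 = n \<and> R 3 = 0) (for_loop 7 0 (\<lambda>_. [Add 16 16 0]))
      (n * (1 + 5) + 2) (?J3 n)"
    by (rule triple_for_loop, simp, rule triple_code) (auto simp: base_def)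
  have 4: "triple (?J3 n) (\<lambda>_. [Sub 17 0 4]) 1 (\<lambda>R M. ?J4 0 R M \<and> R 17 = n - 1 \<and> R 3 = 0)"
    by (rule triple_code) (auto simp: base_def power2_eq_square)
  have 5: "triple (\<lambda>R M. ?J4 0 R M \<and> R 17 = n - 1 \<and> R 3 = 0)
      (for_loop 7 17 (\<lambda>_. [Add 15 15 16, Add 15 15 16])) ((n - 1) * (2 + 5) + 2) (?J4 (n - 1))"
    by (rule triple_for_loop, simp, rule triple_code) (auto simp: base_def)
  have 6: "triple (?J4 (n - 1))
      (\<lambda>_. [Add 14 14 14, Add 14 14 14, Add 14 14 14, Sub 15 15 14, Sub 0 4 15]) 5
      (\<lambda>R M. R 0 = 1 \<longleftrightarrow> n * b + 2 * (n - 1) * n\<^sup>2 \<le> 8 * ?q)"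
    by (rule triple_code) (auto simp: base_def)
  have one: "triple (\<lambda>R M. ?J1 0 R M \<and> R 0 = n \<and> R 3 = 0) (for_loop 7 0 row_prog)
      (n * (14 * n + 5 + 5) + 2) (\<lambda>R M. ?J2 0 R M \<and> R 0 = n \<and> R 3 = 0)"
    by (rule triple_conseq[OF 1]) (auto simp: base_def)
  have two: "triple (\<lambda>R M. ?J2 0 R M \<and> R 0 = n \<and> R 3 = 0) (for_loop 7 0 (\<lambda>_. [Add 15 15 10]))
      (n * (1 + 5) + 2) (\<lambda>R M. ?J3 0 R M \<and> R 0 = n \<and> R 3 = 0)"
    by (rule triple_conseq[OF 2]) (auto simp: base_def)
  show ?thesis
    unfolding test_prog_def
    by (rule triple_conseq[OF triple_seq[OF 0 triple_seq[OF one triple_seq[OF two triple_seq[OF 3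
        triple_seq[OF 4 triple_seq[OF 5 6]]]]]]])
      (auto simp: power2_eq_square algebra_simps)
qed

section \<open>Computing the two threshold parameters\<close>

definition init_prog :: block where
  "init_prog = (\<lambda>_. [Const 3 0, Const 4 1, Const 9 0, Const 10 0])"

text \<open>For \<open>w = parameter_digits \<gamma> n\<close> the quotient of \<open>n * w\<close>
  by \<open>2 ^ n\<close> approximates n gamma. Division is by repeated subtraction limited to n
  rounds, the origin of the minimum with n below. The pair \<open>Sub 8 5 6, Sub 8 4 8\<close>
  leaves in register 8 the truth value of \<open>2 ^ n\<close> <= remainder, which is then the
  number of rounds of the inner loop, a conditional.\<close>

definition digits_prog :: block where
  "digits_prog =
     (\<lambda>_. [Const 5 1, Const 6 0]) ;;
     for_loop 7 0 (\<lambda>_. [Add 5 5 5, Add 6 6 1]) ;;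
     for_loop 7 0 ((\<lambda>_. [Sub 8 5 6, Sub 8 4 8]) ;; for_loop 11 8 (\<lambda>_. [Sub 6 6 5, Add 9 9 4])) ;;
     for_loop 7 9 (\<lambda>_. [Add 10 10 9])"

text \<open>Register 9 holds r and register 6 holds r^2; the next square r^2 + 2 r + 1, in register
  12, is accepted while it is at most n. \<open>Add 6 12 3\<close> is a copy, as register 3 is 0.
  Since the root of n is at most n, n rounds suffice.\<close>

definition sqrt_prog :: block where
  "sqrt_prog =
     (\<lambda>_. [Const 6 0]) ;;
     for_loop 7 0 ((\<lambda>_. [Add 8 9 9, Add 8 8 6, Add 12 8 4, Sub 8 12 0, Sub 8 4 8]) ;;
       for_loop 11 8 (\<lambda>_. [Add 9 9 4, Add 6 12 3])) ;;
     (\<lambda>_. [Const 8 16]) ;;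
     for_loop 7 8 (\<lambda>_. [Add 10 10 9])"

lemma triple_digits_prog:
  "triple (\<lambda>R M. base n M0 R M \<and> R 1 = w \<and> R 9 = 0 \<and> R 10 = 0) digits_prog (33 * n + 8)
    (\<lambda>R M. base n M0 R M \<and> R 10 = (min n (n * w div 2 ^ n))\<^sup>2)"
proof -
  define a where "a = min n (n * w div 2 ^ n)"
  let ?J1 = "\<lambda>k R M. base n M0 R M \<and> R 1 = w \<and> R 9 = 0 \<and> R 10 = 0 \<and> R 5 = 2 ^ k \<and> R 6 = k * w"
  \<comment> \<open>Division invariant after k rounds: either every round has subtracted, or the
    remainder is already below \<open>2 ^ n\<close>.\<close>
  let ?P = "\<lambda>k R. R (9::nat) \<le> (k::nat) \<and> R 6 + R 9 * 2 ^ n = n * w \<and> (R 9 = k \<or> R 6 < (2::nat) ^ n)"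
  let ?J2 = "\<lambda>k R M. base n M0 R M \<and> R 5 = 2 ^ n \<and> R 10 = 0 \<and> ?P k R"
  let ?J3 = "\<lambda>k R M. base n M0 R M \<and> R 9 = a \<and> R 10 = k * a"
  have 0: "triple (\<lambda>R M. base n M0 R M \<and> R 1 = w \<and> R 9 = 0 \<and> R 10 = 0)
      (\<lambda>_. [Const 5 1, Const 6 0]) 2 (\<lambda>R M. ?J1 0 R M \<and> R 0 = n \<and> R 3 = 0)"
    by (rule triple_code) (auto simp: base_def)
  have "triple (\<lambda>R M. ?J1 0 R M \<and> R 0 = n \<and> R 3 = 0) (for_loop 7 0 (\<lambda>_. [Add 5 5 5, Add 6 6 1]))
      (n * (2 + 5) + 2) (?J1 n)"
    by (rule triple_for_loop, simp, rule triple_code) (auto simp: base_def)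
  then have 1: "triple (\<lambda>R M. ?J1 0 R M \<and> R 0 = n \<and> R 3 = 0) (for_loop 7 0 (\<lambda>_. [Add 5 5 5, Add 6 6 1]))
      (n * (2 + 5) + 2) (\<lambda>R M. ?J2 0 R M \<and> R 0 = n \<and> R 3 = 0)"
    by (rule triple_conseq) (auto simp: base_def)
  have 2: "triple (\<lambda>R M. ?J2 0 R M \<and> R 0 = n \<and> R 3 = 0)
      (for_loop 7 0 ((\<lambda>_. [Sub 8 5 6, Sub 8 4 8]) ;; for_loop 11 8 (\<lambda>_. [Sub 6 6 5, Add 9 9 4])))
      (n * (2 + (1 * (2 + 5) + 2) + 5) + 2) (?J2 n)"
  proof (rule triple_for_loop)
    fix k assume "k < n"
    let ?b = "for_loop 11 8 (\<lambda>_. [Sub 6 6 5, Add 9 9 4])"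
    let ?G = "\<lambda>R M. base n M0 R M \<and> R 5 = 2 ^ n \<and> R 10 = 0 \<and> R 7 = n - k"
    \<comment> \<open>A conditional as a loop of one round: the index j separates the state before
      the branch (j = 0) from the state after it (j = 1).\<close>
    have yes: "triple (\<lambda>R M. ?G R M \<and> ?P k R \<and> 2 ^ n \<le> R 6 \<and> R 8 = 1) ?b (1 * (2 + 5) + 2)
        (\<lambda>R M. ?G R M \<and> ?P (Suc k) R)"
    proof (rule triple_conseq[OF triple_for_loop[where N = 1 and
        J = "\<lambda>j R M. ?G R M \<and> (j = 0 \<longrightarrow> ?P k R \<and> 2 ^ n \<le> R 6) \<and> (j = 1 \<longrightarrow> ?P (Suc k) R)"]])
      show "triple (\<lambda>R M. (?G R M \<and> (j = 0 \<longrightarrow> ?P k R \<and> 2 ^ n \<le> R 6) \<and> (j = 1 \<longrightarrow> ?P (Suc k) R)) \<and> R 11 = 1 - j)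
         (\<lambda>_. [Sub 6 6 5, Add 9 9 4]) 2
         (\<lambda>R M. (?G R M \<and> (Suc j = 0 \<longrightarrow> ?P k R \<and> 2 ^ n \<le> R 6) \<and> (Suc j = 1 \<longrightarrow> ?P (Suc k) R)) \<and> R 11 = 1 - j)"
        if "j < 1" for j
        by (rule triple_code) (use that in \<open>auto simp: base_def\<close>)
    qed (auto simp: base_def)
    have no: "triple (\<lambda>R M. ?G R M \<and> ?P k R \<and> R 6 < 2 ^ n \<and> R 8 = 0) ?b (0 * (2 + 5) + 2)
        (\<lambda>R M. ?G R M \<and> ?P (Suc k) R)"
      by (rule triple_conseq[OF triple_for_loop[where N = 0 and
        J = "\<lambda>_ R M. ?G R M \<and> ?P k R \<and> R 6 < 2 ^ n"]]) (auto simp: base_def)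
    have both: "triple (\<lambda>R M. ?G R M \<and> ?P k R \<and> R 8 = (if 2 ^ n \<le> R 6 then 1 else 0)) ?b
        (1 * (2 + 5) + 2) (\<lambda>R M. ?G R M \<and> ?P (Suc k) R)"
      by (rule triple_cases[where C = "\<lambda>R M. 2 ^ n \<le> R 6"]; rule triple_conseq[OF yes] triple_conseq[OF no])
         (auto simp: not_le)
    have "triple (\<lambda>R M. ?G R M \<and> ?P k R) (\<lambda>_. [Sub 8 5 6, Sub 8 4 8]) 2
       (\<lambda>R M. ?G R M \<and> ?P k R \<and> R 8 = (if 2 ^ n \<le> R 6 then 1 else 0))"
      by (rule triple_code) (auto simp: base_def)
    from triple_seq[OF this both]
    show "triple (\<lambda>R M. ?J2 k R M \<and> R 7 = n - k)
      ((\<lambda>_. [Sub 8 5 6, Sub 8 4 8]) ;; ?b) (2 + (1 * (2 + 5) + 2))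
      (\<lambda>R M. ?J2 (Suc k) R M \<and> R 7 = n - k)"
      by (rule triple_conseq) auto
  qed (auto simp: base_def)
  have a: "R 9 = a" if "?J2 n R M" for R M
  proof -
    have eq: "n * w = R 6 + R 9 * 2 ^ n" using that by simp
    have div: "n * w div 2 ^ n = R 6 div 2 ^ n + R 9"
      unfolding eq by simp
    \<comment> \<open>If the remainder is still at least \<open>2 ^ n\<close> after n rounds, all n
      rounds have subtracted, and the minimum is n.\<close>
    show ?thesis
    proof (cases "R 6 < 2 ^ n")
      case True
      then show ?thesis using that unfolding a_def div by simp
    next
      case False
      then show ?thesis using that unfolding a_def div by auto
    qed
  qed
  have two: "triple (\<lambda>R M. ?J2 0 R M \<and> R 0 = n \<and> R 3 = 0)
      (for_loop 7 0 ((\<lambda>_. [Sub 8 5 6, Sub 8 4 8]) ;; for_loop 11 8 (\<lambda>_. [Sub 6 6 5, Add 9 9 4])))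
      (n * (2 + (1 * (2 + 5) + 2) + 5) + 2) (\<lambda>R M. ?J3 0 R M \<and> R 9 = a \<and> R 3 = 0)"
  proof (rule triple_conseq[OF 2])
    fix R M assume J: "?J2 n R M"
    then have "R 9 = a" by (rule a)
    then show "?J3 0 R M \<and> R 9 = a \<and> R 3 = 0" using J by (simp add: base_def)
  qed auto
  have 3: "triple (\<lambda>R M. ?J3 0 R M \<and> R 9 = a \<and> R 3 = 0) (for_loop 7 9 (\<lambda>_. [Add 10 10 9]))
      (a * (1 + 5) + 2) (?J3 a)"
    by (rule triple_for_loop, simp, rule triple_code) (auto simp: base_def)
  have "a \<le> n" by (simp add: a_def)
  then show ?thesis
    unfolding digits_prog_def
    by (intro triple_conseq[OF triple_seq[OF 0 triple_seq[OF 1 triple_seq[OF two 3]]]])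
      (auto simp: power2_eq_square a_def[symmetric])
qed

lemma triple_sqrt_prog:
  "triple (\<lambda>R M. base n M0 R M \<and> R 9 = 0 \<and> R 10 = 0) sqrt_prog (21 * n + 106)
    (\<lambda>R M. base n M0 R M \<and> R 10 = 16 * floor_sqrt n)"
proof -
  let ?P = "\<lambda>k R. R (9::nat) \<le> (k::nat) \<and> R 6 = (R 9)\<^sup>2 \<and> R 6 \<le> n \<and> (R 9 = k \<or> n < (Suc (R 9))\<^sup>2)"
  let ?J2 = "\<lambda>k R M. base n M0 R M \<and> R 10 = 0 \<and> ?P k R"
  let ?r = "floor_sqrt n"
  let ?J3 = "\<lambda>k R M. base n M0 R M \<and> R 9 = ?r \<and> R 10 = k * ?r"
  have 0: "triple (\<lambda>R M. base n M0 R M \<and> R 9 = 0 \<and> R 10 = 0)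
      (\<lambda>_. [Const 6 0]) 1 (\<lambda>R M. ?J2 0 R M \<and> R 0 = n \<and> R 3 = 0)"
    by (rule triple_code) (auto simp: base_def)
  let ?c = "\<lambda>_. [Add 8 9 9, Add 8 8 6, Add 12 8 4, Sub 8 12 0, Sub 8 4 8]"
  let ?b = "for_loop 11 8 (\<lambda>_. [Add 9 9 4, Add 6 12 3])"
  have 2: "triple (\<lambda>R M. ?J2 0 R M \<and> R 0 = n \<and> R 3 = 0) (for_loop 7 0 (?c ;; ?b))
      (n * (5 + (1 * (2 + 5) + 2) + 5) + 2) (?J2 n)"
  proof (rule triple_for_loop)
    fix k assume "k < n"
    let ?G = "\<lambda>R M. base n M0 R M \<and> R 10 = 0 \<and> R 7 = n - k"
    let ?S = "\<lambda>R. R (12::nat) = (Suc (R (9::nat)))\<^sup>2"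
    have yes: "triple (\<lambda>R M. ?G R M \<and> ?P k R \<and> ?S R \<and> R 12 \<le> n \<and> R 8 = 1) ?b (1 * (2 + 5) + 2)
        (\<lambda>R M. ?G R M \<and> ?P (Suc k) R)"
    proof (rule triple_conseq[OF triple_for_loop[where N = 1 and
        J = "\<lambda>j R M. ?G R M \<and> (j = 0 \<longrightarrow> ?P k R \<and> ?S R \<and> R 12 \<le> n) \<and> (j = 1 \<longrightarrow> ?P (Suc k) R)"]])
      show "triple (\<lambda>R M. (?G R M \<and> (j = 0 \<longrightarrow> ?P k R \<and> ?S R \<and> R 12 \<le> n) \<and> (j = 1 \<longrightarrow> ?P (Suc k) R)) \<and> R 11 = 1 - j)
         (\<lambda>_. [Add 9 9 4, Add 6 12 3]) 2
         (\<lambda>R M. (?G R M \<and> (Suc j = 0 \<longrightarrow> ?P k R \<and> ?S R \<and> R 12 \<le> n) \<and> (Suc j = 1 \<longrightarrow> ?P (Suc k) R)) \<and> R 11 = 1 - j)"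
        if "j < 1" for j
        by (rule triple_code) (use that in \<open>auto simp: base_def\<close>)
    qed (auto simp: base_def)
    have no: "triple (\<lambda>R M. ?G R M \<and> ?P k R \<and> ?S R \<and> n < R 12 \<and> R 8 = 0) ?b (0 * (2 + 5) + 2)
        (\<lambda>R M. ?G R M \<and> ?P (Suc k) R)"
      by (rule triple_conseq[OF triple_for_loop[where N = 0 and
        J = "\<lambda>_ R M. ?G R M \<and> ?P k R \<and> ?S R \<and> n < R 12"]]) (auto simp: base_def)
    have both: "triple (\<lambda>R M. ?G R M \<and> ?P k R \<and> ?S R \<and> R 8 = (if R 12 \<le> n then 1 else 0)) ?b
        (1 * (2 + 5) + 2) (\<lambda>R M. ?G R M \<and> ?P (Suc k) R)"
      by (rule triple_cases[where C = "\<lambda>R M. R 12 \<le> n"]; rule triple_conseq[OF yes] triple_conseq[OF no])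
         (auto simp: not_le)
    have "triple (\<lambda>R M. ?G R M \<and> ?P k R) ?c 5
       (\<lambda>R M. ?G R M \<and> ?P k R \<and> ?S R \<and> R 8 = (if R 12 \<le> n then 1 else 0))"
      by (rule triple_code) (auto simp: base_def power2_eq_square)
    from triple_seq[OF this both]
    show "triple (\<lambda>R M. ?J2 k R M \<and> R 7 = n - k) (?c ;; ?b) (5 + (1 * (2 + 5) + 2))
      (\<lambda>R M. ?J2 (Suc k) R M \<and> R 7 = n - k)"
      by (rule triple_conseq) auto
  qed (auto simp: base_def)
  have r: "R 9 = ?r" if "?J2 n R M" for R M
  proof -
    \<comment> \<open>If all n rounds have incremented, R 9 = n and the inequality holds
      anyway.\<close>
    have "n < (Suc (R 9))\<^sup>2"
      using that by (auto simp: power2_eq_square)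
    then show ?thesis using that by (intro floor_sqrt_unique[symmetric]) auto
  qed
  have two: "triple (\<lambda>R M. ?J2 0 R M \<and> R 0 = n \<and> R 3 = 0) (for_loop 7 0 (?c ;; ?b))
      (n * (5 + (1 * (2 + 5) + 2) + 5) + 2) (?J3 0)"
  proof (rule triple_conseq[OF 2])
    fix R M assume J: "?J2 n R M"
    then have "R 9 = ?r" by (rule r)
    then show "?J3 0 R M" using J by simp
  qed auto
  have 3: "triple (?J3 0) (\<lambda>_. [Const 8 16]) 1 (\<lambda>R M. ?J3 0 R M \<and> R 8 = 16 \<and> R 3 = 0)"
    by (rule triple_code) (auto simp: base_def)
  have 4: "triple (\<lambda>R M. ?J3 0 R M \<and> R 8 = 16 \<and> R 3 = 0) (for_loop 7 8 (\<lambda>_. [Add 10 10 9]))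
      (16 * (1 + 5) + 2) (?J3 16)"
    by (rule triple_for_loop, simp, rule triple_code) (auto simp: base_def)
  show ?thesis
    unfolding sqrt_prog_def
    by (rule triple_conseq[OF triple_seq[OF 0 triple_seq[OF two triple_seq[OF 3 4]]]]) auto
qed

section \<open>The degree test and its running time\<close>

definition outdegree :: "nat \<Rightarrow> tmatrix \<Rightarrow> nat \<Rightarrow> nat" where
  "outdegree n T i = card {j. j < n \<and> T i j = 1}"

text \<open>This is n b / 2 <= wedge sum, doubled and rewritten by
  \<open>wedge_sum_outdegree\<close> so that only natural numbers occur. At n = 0 the truncated
  \<open>n - 1\<close> is multiplied by 0.\<close>

definition degree_test :: "(nat \<Rightarrow> nat) \<Rightarrow> test" where
  "degree_test b n T = return_pmf (n * b n + 2 * (n - 1) * n\<^sup>2 \<le> 8 * (\<Sum>i<n. (outdegree n T i)\<^sup>2))"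

text \<open>One argument for both tests: \<open>c\<close> is any block that computes
  \<open>b n\<close> in linear time from n and the extra input \<open>w n\<close>.\<close>

lemma polynomial_time_degree_test:
  assumes c: "\<And>n M0. triple (\<lambda>R M. base n M0 R M \<and> R 1 = w n \<and> R 9 = 0 \<and> R 10 = 0) c (K * n + L)
    (\<lambda>R M. base n M0 R M \<and> R 10 = b n)"
  shows "polynomial_time_with w (degree_test b)"
proof -
  let ?P = "(init_prog ;; c ;; test_prog) 0"
  have "halts_with ?P (initial_config n (w n) T) ((61 + K + L) * (n + 1)\<^sup>2)
      (n * b n + 2 * (n - 1) * n\<^sup>2 \<le> 8 * (\<Sum>i<n. (outdegree n T i)\<^sup>2))" for n T
  proof -
    obtain R0 M0 where init: "initial_config n (w n) T = (0, R0, M0)"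
      "R0 = (\<lambda>_. 0)(0 := n, 1 := w n)"
      "M0 = (\<lambda>a. if a < n * n \<and> T (a div n) (a mod n) = 1 then 1 else 0)"
      unfolding initial_config_def by blast
    have M0: "M0 (i * n + j) = (if T i j = 1 then 1 else 0)" if "i < n" "j < n" for i j
    proof -
      have "i * n + j < Suc i * n" using that by simp
      also have "\<dots> \<le> n * n" using that by (intro mult_le_mono1) simp
      finally show ?thesis using that init(3) by simp
    qed
    have deg: "(\<Sum>j<n. M0 (i * n + j)) = outdegree n T i" if "i < n" for i
    proof -
      have "(\<Sum>j<n. M0 (i * n + j)) = (\<Sum>j<n. if T i j = 1 then 1 else 0)"
        using that by (intro sum.cong) (auto simp: M0)
      also have "\<dots> = card ({..<n} \<inter> {j. T i j = 1})"
        by (simp add: sum.If_cases)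
      also have "{..<n} \<inter> {j. T i j = 1} = {j. j < n \<and> T i j = 1}" by auto
      finally show ?thesis by (simp add: outdegree_def)
    qed
    have "outdegree n T i \<le> n" for i
      unfolding outdegree_def using card_mono[of "{..<n}" "{j. j < n \<and> T i j = 1}"] by auto
    then have 2: "triple (\<lambda>R M. base n M0 R M \<and> R 10 = b n) test_prog (14 * n\<^sup>2 + 29 * n + 18)
        (\<lambda>R M. R 0 = 1 \<longleftrightarrow> n * b n + 2 * (n - 1) * n\<^sup>2 \<le> 8 * (\<Sum>i<n. (\<Sum>j<n. M0 (i * n + j))\<^sup>2))"
      by (intro triple_test_prog) (simp add: deg)
    have 0: "triple (\<lambda>R M. R = R0 \<and> M = M0) init_prog 4
        (\<lambda>R M. base n M0 R M \<and> R 1 = w n \<and> R 9 = 0 \<and> R 10 = 0)"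
      unfolding init_prog_def by (rule triple_code) (auto simp: base_def init(2))
    obtain R M where 3: "steps ?P (0, R0, M0) (4 + (K * n + L + (14 * n\<^sup>2 + 29 * n + 18))) (0 + length ?P, R, M)"
      "R 0 = 1 \<longleftrightarrow> n * b n + 2 * (n - 1) * n\<^sup>2 \<le> 8 * (\<Sum>i<n. (\<Sum>j<n. M0 (i * n + j))\<^sup>2)"
      using tripleD[OF triple_seq[OF 0 triple_seq[OF c 2]] code_at_self] by blast
    have "4 + (K * n + L + (14 * n\<^sup>2 + 29 * n + 18)) \<le> (61 + K + L) * (n + 1)\<^sup>2"
      by (simp add: power2_eq_square algebra_simps)
    from steps_halts_with[OF 3(1) _ this] show ?thesis
      using 3(2) by (simp add: init(1) deg)
  qed
  then show ?thesis
    unfolding polynomial_time_with_def degree_test_def by blast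
qed

lemma polynomial_time_digits:
  "polynomial_time_with w (degree_test (\<lambda>n. (min n (n * w n div 2 ^ n))\<^sup>2))"
proof (rule polynomial_time_degree_test)
  show "triple (\<lambda>R M. base n M0 R M \<and> R 1 = w n \<and> R 9 = 0 \<and> R 10 = 0) digits_prog (33 * n + 8)
    (\<lambda>R M. base n M0 R M \<and> R 10 = (min n (n * w n div 2 ^ n))\<^sup>2)" for n M0
    by (rule triple_digits_prog)
qed

lemma polynomial_time_sqrt: "polynomial_time (degree_test (\<lambda>n. 16 * floor_sqrt n))"
proof (rule polynomial_time_degree_test)
  show "triple (\<lambda>R M. base n M0 R M \<and> R 1 = 0 \<and> R 9 = 0 \<and> R 10 = 0) sqrt_prog (21 * n + 106)
    (\<lambda>R M. base n M0 R M \<and> R 10 = 16 * floor_sqrt n)" for n M0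
    by (rule triple_conseq[OF triple_sqrt_prog]) auto
qed

section \<open>Variance of the wedge sum\<close>

lemma finite_set_Pi_pmf:
  assumes "finite A" "\<And>x. x \<in> A \<Longrightarrow> finite (set_pmf (p x))"
  shows "finite (set_pmf (Pi_pmf A dflt p))"
  using assms by (subst set_Pi_pmf) (auto intro!: finite_PiE_dflt)

text \<open>Independence makes expectations of products factor; finite supports make all functions
  integrable, so the induction over \<open>A\<close> can split off one coordinate for arbitrary
  \<open>f\<close>.\<close>

lemma expectation_prod_Pi_pmf_finite:
  fixes f :: "'a \<Rightarrow> 'b \<Rightarrow> real"
  assumes "finite A" "\<And>x. x \<in> A \<Longrightarrow> finite (set_pmf (p x))"
  shows "measure_pmf.expectation (Pi_pmf A dflt p) (\<lambda>y. \<Prod>x\<in>A. f x (y x)) =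
    (\<Prod>x\<in>A. measure_pmf.expectation (p x) (f x))"
  using assms
proof (induction A rule: finite_induct)
  case empty
  then show ?case by simp
next
  case (insert a A)
  have fin: "finite (set_pmf (p a))" "finite (set_pmf (Pi_pmf A dflt p))"
    using insert by (auto intro!: finite_set_Pi_pmf)
  have eq: "(\<Prod>x\<in>insert a A. f x ((g(a := y)) x)) = f a y * (\<Prod>x\<in>A. f x (g x))" for g y
  proof -
    have "(\<Prod>x\<in>A. f x ((g(a := y)) x)) = (\<Prod>x\<in>A. f x (g x))"
      using insert.hyps by (intro prod.cong) auto
    then show ?thesis using insert.hyps by simp
  qed
  have "measure_pmf.expectation (Pi_pmf (insert a A) dflt p) (\<lambda>y. \<Prod>x\<in>insert a A. f x (y x)) =
    (\<Sum>y\<in>set_pmf (p a). pmf (p a) y *\<^sub>R measure_pmf.expectation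
       (Pi_pmf A dflt p \<bind> (\<lambda>g. return_pmf (g(a := y)))) (\<lambda>y. \<Prod>x\<in>insert a A. f x (y x)))"
    unfolding Pi_pmf_insert'[OF insert.hyps]
    by (rule pmf_expectation_bind) (use fin in auto)
  also have "\<dots> = (\<Sum>y\<in>set_pmf (p a). pmf (p a) y * (f a y * (\<Prod>x\<in>A. measure_pmf.expectation (p x) (f x))))"
    by (intro sum.cong refl)
      (simp only: map_pmf_def[symmetric] integral_map_pmf eq real_scaleR_def
        Bochner_Integration.integral_mult_right_zero, simp add: insert)
  also have "\<dots> = measure_pmf.expectation (p a) (f a) * (\<Prod>x\<in>A. measure_pmf.expectation (p x) (f x))"
    unfolding integral_measure_pmf[OF fin(1), of "p a" "f a", simplified]
    by (simp add: sum_distrib_left sum_distrib_right mult_ac)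
  finally show ?case using insert.hyps by simp
qed

text \<open>Distinct monomials in independent centred variables are orthogonal; \<open>m\<close> bounds how often
  a monomial is repeated in the sum.\<close>

lemma expectation_square_sum_monomials:
  fixes z :: "'b \<Rightarrow> real" and c :: "'t \<Rightarrow> real" and A :: "'t \<Rightarrow> 'a set"
  assumes fin: "finite E" "finite I" "finite (set_pmf p)"
    and A: "\<And>t. t \<in> I \<Longrightarrow> A t \<subseteq> E"
    and mean: "measure_pmf.expectation p z = 0"
    and var: "measure_pmf.expectation p (\<lambda>b. (z b)\<^sup>2) \<le> 1"
    and mult: "\<And>t. t \<in> I \<Longrightarrow> card {s \<in> I. A s = A t} \<le> m"
  shows "measure_pmf.expectation (Pi_pmf E d (\<lambda>_. p))
    (\<lambda>y. (\<Sum>t\<in>I. c t * (\<Prod>e\<in>A t. z (y e)))\<^sup>2) \<le> m * (\<Sum>t\<in>I. (c t)\<^sup>2)"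
proof -
  let ?P = "Pi_pmf E d (\<lambda>_. p)"
  let ?v = "\<lambda>s t. measure_pmf.expectation ?P (\<lambda>y. (\<Prod>e\<in>A s. z (y e)) * (\<Prod>e\<in>A t. z (y e)))"
  have int [simp]: "integrable (measure_pmf ?P) g" for g :: "_ \<Rightarrow> real"
    by (rule integrable_measure_pmf_finite) (use fin in \<open>auto intro!: finite_set_Pi_pmf\<close>)
  have v: "?v s t = (\<Prod>e\<in>E. measure_pmf.expectation p (\<lambda>b.
      (if e \<in> A s then z b else 1) * (if e \<in> A t then z b else 1)))" if "s \<in> I" "t \<in> I" for s t
  proof -
    have *: "(\<Prod>e\<in>A t. z (y e)) = (\<Prod>e\<in>E. if e \<in> A t then z (y e) else 1)" if "t \<in> I" for t y
      using A[OF that] fin by (simp add: prod.If_cases Int_absorb1)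
    show ?thesis
      unfolding *[OF that(1)] *[OF that(2)] prod.distrib[symmetric]
      by (rule expectation_prod_Pi_pmf_finite) (use fin in auto)
  qed
  \<comment> \<open>A coordinate that occurs in exactly one of the two monomials contributes the
    factor E z = 0.\<close>
  have diff: "?v s t = 0" if st: "s \<in> I" "t \<in> I" "A s \<noteq> A t" for s t
  proof -
    obtain e where e: "e \<in> E" "e \<in> A s \<longleftrightarrow> e \<notin> A t"
      using A[OF st(1)] A[OF st(2)] st(3) by blast
    then have "measure_pmf.expectation p (\<lambda>b.
      (if e \<in> A s then z b else 1) * (if e \<in> A t then z b else 1)) = 0"
      using mean by auto
    then show ?thesis
      unfolding v[OF st(1,2)] using fin e(1) by (auto intro: prod_zero)
  qed
  have same: "\<bar>?v s t\<bar> \<le> 1" if "s \<in> I" "t \<in> I" "A s = A t" for s t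
  proof -
    have "?v s t = (\<Prod>e\<in>E. if e \<in> A t then measure_pmf.expectation p (\<lambda>b. (z b)\<^sup>2) else 1)"
      unfolding v[OF that(1,2)] using that(3)
      by (intro prod.cong) (auto simp: power2_eq_square)
    also have "\<bar>\<dots>\<bar> \<le> 1"
      unfolding abs_prod by (intro prod_le_1) (use var in auto)
    finally show ?thesis .
  qed
  have "measure_pmf.expectation ?P (\<lambda>y. (\<Sum>t\<in>I. c t * (\<Prod>e\<in>A t. z (y e)))\<^sup>2) =
    measure_pmf.expectation ?P (\<lambda>y. \<Sum>s\<in>I. \<Sum>t\<in>I.
      c s * c t * ((\<Prod>e\<in>A s. z (y e)) * (\<Prod>e\<in>A t. z (y e))))"
    by (simp add: power2_eq_square sum_product mult_ac)
  also have "\<dots> = (\<Sum>s\<in>I. \<Sum>t\<in>I. c s * c t * ?v s t)"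
    by (simp add: Bochner_Integration.integral_sum)
  \<comment> \<open>Only pairs with equal monomials survive, and the mixed coefficients are split by
    2 |x y| <= x^2 + y^2, so that the number of repetitions of each monomial can be counted.\<close>
  also have "\<dots> \<le> (\<Sum>s\<in>I. \<Sum>t\<in>I. if A s = A t then ((c s)\<^sup>2 + (c t)\<^sup>2) / 2 else 0)"
  proof (intro sum_mono)
    fix s t assume st: "s \<in> I" "t \<in> I"
    show "c s * c t * ?v s t \<le> (if A s = A t then ((c s)\<^sup>2 + (c t)\<^sup>2) / 2 else 0)"
    proof (cases "A s = A t")
      case True
      have "c s * c t * ?v s t \<le> \<bar>c s * c t\<bar> * \<bar>?v s t\<bar>"
        by (simp only: abs_mult[symmetric] abs_ge_self)
      also have "\<dots> \<le> \<bar>c s * c t\<bar> * 1"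
        by (rule mult_left_mono[OF same[OF st True] abs_ge_zero])
      also have "\<dots> \<le> ((c s)\<^sup>2 + (c t)\<^sup>2) / 2"
        using sum_squares_bound[of "\<bar>c s\<bar>" "\<bar>c t\<bar>"] by (simp add: abs_mult)
      finally show ?thesis using True by simp
    next
      case False
      then show ?thesis by (simp only: diff[OF st False]) simp
    qed
  qed
  also have "\<dots> = (\<Sum>s\<in>I. \<Sum>t\<in>I. if A t = A s then (c s)\<^sup>2 / 2 else 0) +
      (\<Sum>s\<in>I. \<Sum>t\<in>I. if A s = A t then (c t)\<^sup>2 / 2 else 0)"
    unfolding sum.distrib[symmetric] by (intro sum.cong refl) (auto simp: add_divide_distrib)
  also have "(\<Sum>s\<in>I. \<Sum>t\<in>I. if A s = A t then (c t)\<^sup>2 / 2 else 0) =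
      (\<Sum>s\<in>I. \<Sum>t\<in>I. if A t = A s then (c s)\<^sup>2 / 2 else 0)"
    by (rule sum.swap)
  also have "(\<Sum>s\<in>I. \<Sum>t\<in>I. if A t = A s then (c s)\<^sup>2 / 2 else 0) =
      (\<Sum>s\<in>I. card {t \<in> I. A t = A s} * ((c s)\<^sup>2 / 2))"
    by (intro sum.cong refl) (simp add: sum.If_cases fin Int_def)
  also have "\<dots> + \<dots> = (\<Sum>t\<in>I. card {s \<in> I. A s = A t} * (c t)\<^sup>2)"
    unfolding sum.distrib[symmetric] by (intro sum.cong refl) simp
  also have "\<dots> \<le> (\<Sum>t\<in>I. m * (c t)\<^sup>2)"
    by (intro sum_mono mult_right_mono) (use mult in auto)
  finally show ?thesis by (simp add: sum_distrib_left)
qed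

section \<open>The wedge sum: mean and variance given the ranking\<close>

definition wedges :: "nat \<Rightarrow> (nat \<times> nat \<times> nat) set" where
  "wedges n = {(i, j, k). i < n \<and> j < n \<and> k < n \<and> i \<noteq> j \<and> i \<noteq> k \<and> j \<noteq> k}"

lemma wedges_subset: "wedges n \<subseteq> {..<n} \<times> {..<n} \<times> {..<n}"
  by (auto simp: wedges_def)

lemma finite_wedges: "finite (wedges n)"
  by (rule finite_subset[OF wedges_subset]) simp

lemma card_wedges: "card (wedges n) \<le> n ^ 3"
  using card_mono[OF _ wedges_subset, of n] by (simp add: card_cartesian_product power3_eq_cube)

text \<open>Squaring a row sum produces all pairs (j, k); the diagonal j = k contributes n - 1 in
  each row and is taken away.\<close>

lemma sum_wedges:
  fixes g :: "nat \<Rightarrow> nat \<Rightarrow> real"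
  assumes "\<And>i. i < n \<Longrightarrow> g i i = 0" "\<And>i j. i < n \<Longrightarrow> j < n \<Longrightarrow> i \<noteq> j \<Longrightarrow> (g i j)\<^sup>2 = 1"
  shows "(\<Sum>(i, j, k)\<in>wedges n. g i j * g i k) = (\<Sum>i<n. (\<Sum>j<n. g i j)\<^sup>2) - real n * (real n - 1)"
proof -
  have row: "(\<Sum>j<n. \<Sum>k<n. if i \<noteq> j \<and> i \<noteq> k \<and> j \<noteq> k then g i j * g i k else 0) =
      (\<Sum>j<n. g i j)\<^sup>2 - (real n - 1)" if i: "i < n" for i
  proof -
    have "(\<Sum>j<n. \<Sum>k<n. if i \<noteq> j \<and> i \<noteq> k \<and> j \<noteq> k then g i j * g i k else 0) =
        (\<Sum>j<n. \<Sum>k<n. g i j * g i k - (if k = j then (g i j)\<^sup>2 else 0))"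
      by (intro sum.cong refl) (auto simp: assms(1) i power2_eq_square)
    also have "\<dots> = (\<Sum>j<n. g i j)\<^sup>2 - (\<Sum>j<n. (g i j)\<^sup>2)"
      by (simp add: sum_subtractf power2_eq_square sum_product)
    also have "(\<Sum>j<n. (g i j)\<^sup>2) = (\<Sum>j\<in>{..<n} - {i}. (g i j)\<^sup>2)"
      by (rule sum.mono_neutral_right) (auto simp: assms(1) i)
    also have "\<dots> = (\<Sum>j\<in>{..<n} - {i}. 1)"
      by (intro sum.cong) (auto simp: assms(2) i)
    also have "\<dots> = real n - 1" using i by (simp add: of_nat_diff)
    finally show ?thesis .
  qed
  have "(\<Sum>(i, j, k)\<in>wedges n. g i j * g i k) =
      (\<Sum>(i, j, k)\<in>{..<n} \<times> {..<n} \<times> {..<n}. if i \<noteq> j \<and> i \<noteq> k \<and> j \<noteq> k then g i j * g i k else 0)"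
    by (rule sum.mono_neutral_cong_left) (auto simp: wedges_def)
  also have "\<dots> = (\<Sum>i<n. \<Sum>j<n. \<Sum>k<n. if i \<noteq> j \<and> i \<noteq> k \<and> j \<noteq> k then g i j * g i k else 0)"
    by (simp add: sum.cartesian_product)
  also have "\<dots> = (\<Sum>i<n. (\<Sum>j<n. g i j)\<^sup>2 - (real n - 1))"
    by (intro sum.cong refl row) simp
  finally show ?thesis by (simp add: sum_subtractf)
qed

lemma sum_sgn_ranks:
  assumes "p < n"
  shows "(\<Sum>a<n. sgn (real a - real p)) = real n - 1 - 2 * real p"
proof -
  have "{..<n} = {..<p} \<union> {p..<n}" using assms by auto
  then have "(\<Sum>a<n. sgn (real a - real p)) = (\<Sum>a<p. sgn (real a - real p)) + (\<Sum>a=p..<n. sgn (real a - real p))"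
    by (simp add: sum.union_disjoint ivl_disj_int)
  also have "(\<Sum>a=p..<n. sgn (real a - real p)) = (\<Sum>a=Suc p..<n. sgn (real a - real p))"
    using assms by (simp add: sum.atLeast_Suc_lessThan)
  also have "(\<Sum>a<p. sgn (real a - real p)) = (\<Sum>a<p. -1)"
    by (intro sum.cong) auto
  also have "(\<Sum>a=Suc p..<n. sgn (real a - real p)) = (\<Sum>a=Suc p..<n. 1)"
    by (intro sum.cong) auto
  finally show ?thesis using assms by (simp add: of_nat_diff)
qed

text \<open>\<open>c\<close> is kept free because the induction varies \<open>m\<close>, whereas the
  application has m = n and c = n - 1.\<close>

lemma sum_squares_arithmetic:
  "(\<Sum>p<m. (c - 2 * real p)\<^sup>2) =
     m * c\<^sup>2 - 2 * c * m * (real m - 1) + 2 * (real m - 1) * m * (2 * real m - 1) / 3"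
  by (induction m) (auto simp: field_simps power2_eq_square)

definition wedge_sum :: "nat \<Rightarrow> tmatrix \<Rightarrow> real" where
  "wedge_sum n T = (\<Sum>(i, j, k)\<in>wedges n. real_of_int (T i j) * real_of_int (T i k))"

text \<open>Renaming first the neighbours and then the centres by their ranks removes pi, and the
  row sums become n - 1 - 2 i. Hence the planted mean is the same for all rankings.\<close>

lemma sum_wedges_permutes:
  assumes "\<pi> permutes {..<n}"
  shows "(\<Sum>(i, j, k)\<in>wedges n. sgn (real (\<pi> j) - real (\<pi> i)) * sgn (real (\<pi> k) - real (\<pi> i))) =
    real n * (real n - 1) * (real n - 2) / 3"
proof -
  have neq: "\<pi> i \<noteq> \<pi> j" if "i \<noteq> j" for i j
    using that permutes_inj[OF assms] by (metis injD)
  have "(\<Sum>(i, j, k)\<in>wedges n. sgn (real (\<pi> j) - real (\<pi> i)) * sgn (real (\<pi> k) - real (\<pi> i))) =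
    (\<Sum>i<n. (\<Sum>j<n. sgn (real (\<pi> j) - real (\<pi> i)))\<^sup>2) - real n * (real n - 1)"
    by (rule sum_wedges) (auto simp: sgn_if neq)
  also have "(\<Sum>i<n. (\<Sum>j<n. sgn (real (\<pi> j) - real (\<pi> i)))\<^sup>2) =
      (\<Sum>i<n. (\<Sum>j<n. sgn (real j - real (\<pi> i)))\<^sup>2)"
    by (simp add: sum.permute[OF assms, of "\<lambda>j. sgn (real j - real (\<pi> i))" for i] o_def)
  also have "\<dots> = (\<Sum>i<n. (\<Sum>j<n. sgn (real j - real i))\<^sup>2)"
    by (simp add: sum.permute[OF assms, of "\<lambda>i. (\<Sum>j<n. sgn (real j - real i))\<^sup>2"] o_def)
  also have "\<dots> = (\<Sum>i<n. (real n - 1 - 2 * real i)\<^sup>2)"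
    by (intro sum.cong refl) (simp add: sum_sgn_ranks)
  finally show ?thesis
    unfolding sum_squares_arithmetic by (simp add: field_simps power2_eq_square)
qed

text \<open>The bound is three times the sum of three second moments: 2 n^3 for the degree 2 part,
  where a monomial occurs at most twice, and 8 gamma^2 n^4 for each of the two degree 1 parts, whose
  coefficients are 2 gamma in absolute value and whose monomials occur at most 2 n times.\<close>

lemma expectation_wedge_sum:
  assumes \<pi>: "\<pi> permutes {..<n}" and \<gamma>: "0 \<le> \<gamma>" "\<gamma> \<le> 1 / 2"
  shows "measure_pmf.expectation (planted_given n \<gamma> \<pi>)
     (\<lambda>T. (wedge_sum n T - 4 * \<gamma>\<^sup>2 * (real n * (real n - 1) * (real n - 2) / 3))\<^sup>2)
     \<le> 6 * real n ^ 3 + 48 * \<gamma>\<^sup>2 * real n ^ 4"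
proof -
  define s where "s i j = sgn (real (\<pi> j) - real (\<pi> i))" for i j
  \<comment> \<open>The coin that decides the edge between i and j, from whichever end it is
    seen.\<close>
  define e where "e i j = (if \<pi> i < \<pi> j then (i, j) else (j, i))" for i j
  define p where "p = bernoulli_pmf (1 / 2 + \<gamma>)"
  define z where "z b = (if b then 1 else -1) - 2 * \<gamma>" for b
  let ?W = "wedges n"
  let ?P = "Pi_pmf (ranked_pairs n \<pi>) False (\<lambda>_. p)"
  let ?c = "\<lambda>(i, j, k). s i j * s i k"
  let ?Q = "\<lambda>y. \<Sum>t\<in>?W. ?c t * (\<Prod>f\<in>(case t of (i, j, k) \<Rightarrow> {e i j, e i k}). z (y f))"
  let ?L1 = "\<lambda>y. \<Sum>t\<in>?W. (2 * \<gamma> * ?c t) * (\<Prod>f\<in>(case t of (i, j, k) \<Rightarrow> {e i j}). z (y f))"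
  let ?L2 = "\<lambda>y. \<Sum>t\<in>?W. (2 * \<gamma> * ?c t) * (\<Prod>f\<in>(case t of (i, j, k) \<Rightarrow> {e i k}). z (y f))"
  have neq: "\<pi> i \<noteq> \<pi> j" if "i \<noteq> j" for i j
    using that permutes_inj[OF \<pi>] by (metis injD)
  have s1: "\<bar>s i j\<bar> = 1" if "i \<noteq> j" for i j
    using neq[OF that] by (simp add: s_def sgn_if)
  have e_in: "e i j \<in> ranked_pairs n \<pi>" if "i < n" "j < n" "i \<noteq> j" for i j
    using that neq[OF that(3)] by (auto simp: e_def ranked_pairs_def)
  have e_eq: "e i j = e k l \<longleftrightarrow> (i = k \<and> j = l) \<or> (i = l \<and> j = k)" if "i \<noteq> j" "k \<noteq> l" for i j k l
    using neq[OF that(1)] neq[OF that(2)] by (auto simp: e_def)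
  have orient: "real_of_int (orient n \<pi> y i j) = s i j * (2 * \<gamma> + z (y (e i j)))"
    if "i < n" "j < n" "i \<noteq> j" for i j y
    using that neq[OF that(3)] by (auto simp: s_def sgn_if z_def e_def orient_def ranked_pairs_def)
  have p: "set_pmf p \<subseteq> UNIV" "pmf p True = 1 / 2 + \<gamma>" "pmf p False = 1 / 2 - \<gamma>"
    using \<gamma> by (auto simp: p_def)
  have ep: "measure_pmf.expectation p g = (1 / 2 + \<gamma>) * g True + (1 / 2 - \<gamma>) * g False" for g :: "bool \<Rightarrow> real"
    using p by (subst integral_measure_pmf[of UNIV]) (auto simp: UNIV_bool)
  have mean: "measure_pmf.expectation p z = 0"
    by (simp add: ep z_def algebra_simps)
  have var: "measure_pmf.expectation p (\<lambda>b. (z b)\<^sup>2) \<le> 1"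
    by (simp add: ep z_def power2_eq_square algebra_simps)
  have fin: "finite (ranked_pairs n \<pi>)" "finite ?W" "finite (set_pmf p)"
    by (auto simp: finite_ranked_pairs finite_wedges intro: finite_subset[of _ UNIV])
  have int [simp]: "integrable (measure_pmf ?P) g" for g :: "_ \<Rightarrow> real"
    by (rule integrable_measure_pmf_finite) (use fin in \<open>auto intro!: finite_set_Pi_pmf\<close>)
  have c2: "(\<Sum>t\<in>?W. (a * ?c t)\<^sup>2) \<le> a\<^sup>2 * real n ^ 3" for a
  proof -
    have "(\<Sum>t\<in>?W. (a * ?c t)\<^sup>2) = (\<Sum>t\<in>?W. a\<^sup>2)"
    proof (intro sum.cong refl)
      fix t assume "t \<in> ?W"
      then have "\<bar>?c t\<bar> = 1" by (auto simp: wedges_def abs_mult s1)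
      then have "(?c t)\<^sup>2 = 1" by (simp only: abs_square_eq_1)
      then show "(a * ?c t)\<^sup>2 = a\<^sup>2" by (simp add: power_mult_distrib)
    qed
    also have "\<dots> \<le> a\<^sup>2 * real n ^ 3"
    proof -
      have "real (card ?W) \<le> real n ^ 3"
        using card_wedges[of n] by (metis of_nat_le_iff of_nat_power)
      then show ?thesis by (simp add: mult.commute[of "a\<^sup>2"] mult_right_mono)
    qed
    finally show ?thesis .
  qed
  have Q: "measure_pmf.expectation ?P (\<lambda>y. (?Q y)\<^sup>2) \<le> 2 * real n ^ 3"
  proof -
    have "measure_pmf.expectation ?P (\<lambda>y. (?Q y)\<^sup>2) \<le> real 2 * (\<Sum>t\<in>?W. (?c t)\<^sup>2)"
    proof (rule expectation_square_sum_monomials[OF fin _ mean var])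
      fix t assume t: "t \<in> ?W"
      obtain i j k where ijk: "t = (i, j, k)" by (cases t)
      show "(case t of (i, j, k) \<Rightarrow> {e i j, e i k}) \<subseteq> ranked_pairs n \<pi>"
        using t e_in by (auto simp: wedges_def)
      \<comment> \<open>Two distinct edges with a common vertex determine that vertex, the centre;
        only j and k can be exchanged.\<close>
      have "{s \<in> ?W. (case s of (i, j, k) \<Rightarrow> {e i j, e i k}) = (case t of (i, j, k) \<Rightarrow> {e i j, e i k})} \<subseteq>
          {(i, j, k), (i, k, j)}"
        using t ijk by (auto simp: wedges_def doubleton_eq_iff e_eq)
      then have "card {s \<in> ?W. (case s of (i, j, k) \<Rightarrow> {e i j, e i k}) = (case t of (i, j, k) \<Rightarrow> {e i j, e i k})}
          \<le> card {(i, j, k), (i, k, j)}"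
        by (intro card_mono) simp_all
      moreover have "card {(i, j, k), (i, k, j)} \<le> 2"
        using card_insert_le_m1[of 2 "{(i, k, j)}" "(i, j, k)"] by simp
      ultimately show "card {s \<in> ?W. (case s of (i, j, k) \<Rightarrow> {e i j, e i k}) = (case t of (i, j, k) \<Rightarrow> {e i j, e i k})} \<le> 2"
        by (rule order.trans)
    qed
    also have "\<dots> \<le> 2 * real n ^ 3" using c2[of 1] by simp
    finally show ?thesis .
  qed
  \<comment> \<open>An edge may have its centre at either end and leaves the third vertex free,
    whence 2 n repetitions; \<open>u\<close> and \<open>v\<close> list the two cases by the third
    vertex.\<close>
  have L: "measure_pmf.expectation ?P (\<lambda>y. (\<Sum>t\<in>?W. (2 * \<gamma> * ?c t) * (\<Prod>f\<in>A t. z (y f)))\<^sup>2)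
      \<le> 8 * \<gamma>\<^sup>2 * real n ^ 4"
    if A: "\<And>t. t \<in> ?W \<Longrightarrow> A t \<subseteq> ranked_pairs n \<pi>"
      "\<And>t. t \<in> ?W \<Longrightarrow> \<exists>u v. {s \<in> ?W. A s = A t} \<subseteq> u ` {..<n} \<union> v ` {..<n}" for A
  proof -
    have "measure_pmf.expectation ?P (\<lambda>y. (\<Sum>t\<in>?W. (2 * \<gamma> * ?c t) * (\<Prod>f\<in>A t. z (y f)))\<^sup>2) \<le>
        real (2 * n) * (\<Sum>t\<in>?W. (2 * \<gamma> * ?c t)\<^sup>2)"
    proof (rule expectation_square_sum_monomials[OF fin A(1) mean var])
      fix t assume "t \<in> ?W"
      from A(2)[OF this] obtain u v where "{s \<in> ?W. A s = A t} \<subseteq> u ` {..<n} \<union> v ` {..<n}"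
        by blast
      then have "card {s \<in> ?W. A s = A t} \<le> card (u ` {..<n} \<union> v ` {..<n})"
        by (intro card_mono) auto
      also have "\<dots> \<le> card (u ` {..<n}) + card (v ` {..<n})" by (rule card_Un_le)
      also have "\<dots> \<le> n + n" by (intro add_mono) (use card_image_le[of "{..<n}"] in auto)
      finally show "card {s \<in> ?W. A s = A t} \<le> 2 * n" by simp
    qed
    also have "\<dots> \<le> real (2 * n) * ((2 * \<gamma>)\<^sup>2 * real n ^ 3)"
      by (intro mult_left_mono c2) auto
    finally show ?thesis by (simp add: power2_eq_square eval_nat_numeral mult_ac)
  qed
  have L1: "measure_pmf.expectation ?P (\<lambda>y. (?L1 y)\<^sup>2) \<le> 8 * \<gamma>\<^sup>2 * real n ^ 4"
  proof (rule L)
    fix t assume t: "t \<in> ?W"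
    obtain i j k where ijk: "t = (i, j, k)" by (cases t)
    show "(case t of (i, j, k) \<Rightarrow> {e i j}) \<subseteq> ranked_pairs n \<pi>"
      using t e_in by (auto simp: wedges_def)
    have "{s \<in> ?W. (case s of (i, j, k) \<Rightarrow> {e i j}) = (case t of (i, j, k) \<Rightarrow> {e i j})} \<subseteq>
        (\<lambda>l. (i, j, l)) ` {..<n} \<union> (\<lambda>l. (j, i, l)) ` {..<n}"
      using t ijk by (auto simp: wedges_def e_eq)
    then show "\<exists>u v. {s \<in> ?W. (case s of (i, j, k) \<Rightarrow> {e i j}) = (case t of (i, j, k) \<Rightarrow> {e i j})} \<subseteq>
        u ` {..<n} \<union> v ` {..<n}"
      by blast
  qed
  have L2: "measure_pmf.expectation ?P (\<lambda>y. (?L2 y)\<^sup>2) \<le> 8 * \<gamma>\<^sup>2 * real n ^ 4"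
  proof (rule L)
    fix t assume t: "t \<in> ?W"
    obtain i j k where ijk: "t = (i, j, k)" by (cases t)
    show "(case t of (i, j, k) \<Rightarrow> {e i k}) \<subseteq> ranked_pairs n \<pi>"
      using t e_in by (auto simp: wedges_def)
    have "{s \<in> ?W. (case s of (i, j, k) \<Rightarrow> {e i k}) = (case t of (i, j, k) \<Rightarrow> {e i k})} \<subseteq>
        (\<lambda>l. (i, l, k)) ` {..<n} \<union> (\<lambda>l. (k, l, i)) ` {..<n}"
      using t ijk by (auto simp: wedges_def e_eq)
    then show "\<exists>u v. {s \<in> ?W. (case s of (i, j, k) \<Rightarrow> {e i k}) = (case t of (i, j, k) \<Rightarrow> {e i k})} \<subseteq>
        u ` {..<n} \<union> v ` {..<n}"
      by blast
  qed
  have expand: "wedge_sum n (orient n \<pi> y) - 4 * \<gamma>\<^sup>2 * (real n * (real n - 1) * (real n - 2) / 3) =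
      ?Q y + ?L1 y + ?L2 y" for y
  proof -
    have "wedge_sum n (orient n \<pi> y) - 4 * \<gamma>\<^sup>2 * (\<Sum>(i, j, k)\<in>?W. s i j * s i k) =
        (\<Sum>t\<in>?W. (case t of (i, j, k) \<Rightarrow> real_of_int (orient n \<pi> y i j) * real_of_int (orient n \<pi> y i k)) -
           4 * \<gamma>\<^sup>2 * ?c t)"
      unfolding wedge_sum_def by (simp add: sum_subtractf sum_distrib_left)
    also have "\<dots> = (\<Sum>t\<in>?W. ?c t * (\<Prod>f\<in>(case t of (i, j, k) \<Rightarrow> {e i j, e i k}). z (y f)) +
        (2 * \<gamma> * ?c t) * (\<Prod>f\<in>(case t of (i, j, k) \<Rightarrow> {e i j}). z (y f)) +
        (2 * \<gamma> * ?c t) * (\<Prod>f\<in>(case t of (i, j, k) \<Rightarrow> {e i k}). z (y f)))"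
      by (intro sum.cong refl) (auto simp: wedges_def orient e_eq power2_eq_square algebra_simps)
    finally show ?thesis
      unfolding sum_wedges_permutes[OF \<pi>, folded s_def] by (simp add: sum.distrib)
  qed
  have three: "(a + b + c)\<^sup>2 \<le> 3 * a\<^sup>2 + 3 * b\<^sup>2 + 3 * c\<^sup>2" for a b c :: real
    using zero_le_power2[of "a - b"] zero_le_power2[of "b - c"] zero_le_power2[of "a - c"]
    by (simp add: power2_eq_square algebra_simps)
  have "measure_pmf.expectation (planted_given n \<gamma> \<pi>)
     (\<lambda>T. (wedge_sum n T - 4 * \<gamma>\<^sup>2 * (real n * (real n - 1) * (real n - 2) / 3))\<^sup>2) =
     measure_pmf.expectation ?P (\<lambda>y. (?Q y + ?L1 y + ?L2 y)\<^sup>2)"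
    unfolding planted_given_def integral_map_pmf expand p_def ..
  also have "\<dots> \<le> measure_pmf.expectation ?P (\<lambda>y. 3 * (?Q y)\<^sup>2 + 3 * (?L1 y)\<^sup>2 + 3 * (?L2 y)\<^sup>2)"
    by (intro integral_mono three int)
  also have "\<dots> = 3 * measure_pmf.expectation ?P (\<lambda>y. (?Q y)\<^sup>2) +
      3 * measure_pmf.expectation ?P (\<lambda>y. (?L1 y)\<^sup>2) + 3 * measure_pmf.expectation ?P (\<lambda>y. (?L2 y)\<^sup>2)"
    by (simp only: Bochner_Integration.integral_add int Bochner_Integration.integrable_add
        Bochner_Integration.integral_mult_right_zero)
  also have "\<dots> \<le> 6 * real n ^ 3 + 48 * \<gamma>\<^sup>2 * real n ^ 4"
    using Q L1 L2 by linarith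
  finally show ?thesis .
qed

section \<open>Second moment of the likelihood ratio\<close>

text \<open>For t <= 1 it follows from exp t <= 1 + t + t^2, and for t >= 1 from t <= t^2. The
  linear term stands alone so that it can sum to 0 in \<open>sum_exp_order_sum\<close>.\<close>

lemma exp_le_add_exp_square: "exp t \<le> t + exp (t\<^sup>2)" for t :: real
proof -
  have *: "1 + t\<^sup>2 \<le> exp (t\<^sup>2)" by (rule exp_ge_add_one_self)
  consider "t \<le> 0" | "0 \<le> t" "t \<le> 1" | "1 \<le> t" by linarith
  then show ?thesis
  proof cases
    case 1
    have "exp t * (1 - t) \<le> exp t * exp (- t)"
      using exp_ge_add_one_self[of "- t"] by (intro mult_left_mono) auto
    also have "\<dots> = 1" by (simp add: exp_minus)
    \<comment> \<open>The product equals 1 - t^3.\<close>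
    also have "1 \<le> (1 + t + t\<^sup>2) * (1 - t)"
      using 1 mult_nonpos_nonneg[of t "t * t"] by (simp add: algebra_simps power2_eq_square)
    finally have "exp t \<le> 1 + t + t\<^sup>2" using 1 by simp
    then show ?thesis using * by linarith
  next
    case 2
    then show ?thesis using exp_bound[of t] * by linarith
  next
    case 3
    then have "t \<le> t\<^sup>2" by (simp add: power2_eq_square)
    then have "exp t \<le> exp (t\<^sup>2)" by simp
    then show ?thesis using 3 by linarith
  qed
qed

text \<open>The list is read as a ranking, lowest element first; the recursion matches the induction
  that strips the lowest element.\<close>

primrec order_sum :: "('a \<Rightarrow> 'a \<Rightarrow> real) \<Rightarrow> 'a list \<Rightarrow> real" where
  "order_sum s [] = 0"
| "order_sum s (x # xs) = sum_list (map (s x) xs) + order_sum s xs"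

definition pairs :: "nat \<Rightarrow> (nat \<times> nat) set" where
  "pairs n = (SIGMA i:{..<n}. {Suc i..<n})"

lemma finite_pairs: "finite (pairs n)"
  by (simp add: pairs_def)

lemma order_sum_nth:
  "order_sum s xs = (\<Sum>i<length xs. \<Sum>j=Suc i..<length xs. s (xs ! i) (xs ! j))"
proof (induction xs)
  case (Cons x xs)
  have "sum_list (map (s x) xs) = (\<Sum>j=Suc 0..<Suc (length xs). s x ((x # xs) ! j))"
    by (simp add: sum_list_sum_nth sum.shift_bounds_Suc_ivl del: sum.op_ivl_Suc)
  then show ?case
    unfolding order_sum.simps Cons.IH length_Cons sum.lessThan_Suc_shift
    by (simp add: sum.shift_bounds_Suc_ivl del: sum.op_ivl_Suc)
qed simp

text \<open>The first element x contributes its row sum \<open>d x\<close> over \<open>A\<close>,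
  whatever the order of the rest, so the induction hypothesis leaves only the sum of exp (a d x)
  over x. Skew symmetry makes the \<open>d x\<close> add up to 0, which removes the linear term; |d
  x| <= |A| bounds the other one.\<close>

lemma sum_exp_order_sum:
  fixes s :: "'a \<Rightarrow> 'a \<Rightarrow> real"
  assumes "finite A" and skew: "\<And>x y. s x y = - s y x" and bound: "\<And>x y. \<bar>s x y\<bar> \<le> 1"
  shows "(\<Sum>xs\<in>permutations_of_set A. exp (a * order_sum s xs)) \<le>
    fact (card A) * exp (a\<^sup>2 * real (card A) ^ 3)"
  using assms(1)
proof (induction "card A" arbitrary: A)
  case 0
  then show ?case by simp
next
  case (Suc m)
  define d where "d x = (\<Sum>y\<in>A. s x y)" for x
  have s0: "s x x = 0" for x using skew[of x x] by simp
  have "(\<Sum>x\<in>A. d x) = - (\<Sum>x\<in>A. d x)"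
  proof -
    have "(\<Sum>x\<in>A. d x) = (\<Sum>y\<in>A. \<Sum>x\<in>A. s x y)" unfolding d_def by (rule sum.swap)
    also have "\<dots> = (\<Sum>y\<in>A. \<Sum>x\<in>A. - s y x)" by (intro sum.cong refl skew)
    also have "\<dots> = - (\<Sum>x\<in>A. d x)" by (simp add: d_def sum_negf)
    finally show ?thesis .
  qed
  then have d0: "(\<Sum>x\<in>A. d x) = 0" by simp
  have d_le: "\<bar>d x\<bar> \<le> real (Suc m)" for x
  proof -
    have "\<bar>d x\<bar> \<le> (\<Sum>y\<in>A. \<bar>s x y\<bar>)" unfolding d_def by (rule sum_abs)
    also have "\<dots> \<le> (\<Sum>y\<in>A. 1)" by (intro sum_mono bound)
    finally show ?thesis using Suc.hyps(2) by simp
  qed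
  have first: "(\<Sum>x\<in>A. exp (a * d x)) \<le> real (Suc m) * exp (a\<^sup>2 * real (Suc m) ^ 2)"
  proof -
    have "(\<Sum>x\<in>A. exp (a * d x)) \<le> (\<Sum>x\<in>A. a * d x + exp (a\<^sup>2 * real (Suc m) ^ 2))"
    proof (intro sum_mono)
      fix x
      have "(d x)\<^sup>2 \<le> real (Suc m) ^ 2"
        using power_mono[OF d_le[of x], of 2] by simp
      then have "exp ((a * d x)\<^sup>2) \<le> exp (a\<^sup>2 * real (Suc m) ^ 2)"
        by (simp add: power_mult_distrib mult_left_mono)
      then show "exp (a * d x) \<le> a * d x + exp (a\<^sup>2 * real (Suc m) ^ 2)"
        using exp_le_add_exp_square[of "a * d x"] by linarith
    qed
    also have "\<dots> = real (Suc m) * exp (a\<^sup>2 * real (Suc m) ^ 2)"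
      using Suc.hyps(2) by (simp add: sum.distrib sum_distrib_left[symmetric] d0)
    finally show ?thesis .
  qed
  have rest: "(\<Sum>xs\<in>permutations_of_set (A - {x}). exp (a * order_sum s (x # xs))) \<le>
      exp (a * d x) * (fact m * exp (a\<^sup>2 * real m ^ 3))" if "x \<in> A" for x
  proof -
    have m: "m = card (A - {x})" using that Suc.hyps(2) Suc.prems by simp
    have "order_sum s (x # xs) = d x + order_sum s xs" if xs: "xs \<in> permutations_of_set (A - {x})" for xs
    proof -
      have "sum_list (map (s x) xs) = (\<Sum>y\<in>A - {x}. s x y)"
        using permutations_of_setD[OF xs] by (simp add: sum_list_distinct_conv_sum_set)
      also have "\<dots> = d x"
        unfolding d_def using Suc.prems \<open>x \<in> A\<close> s0 by (simp add: sum.remove)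
      finally show ?thesis by simp
    qed
    then have "(\<Sum>xs\<in>permutations_of_set (A - {x}). exp (a * order_sum s (x # xs))) =
        exp (a * d x) * (\<Sum>xs\<in>permutations_of_set (A - {x}). exp (a * order_sum s xs))"
      by (simp add: sum_distrib_left distrib_left exp_add)
    also have "\<dots> \<le> exp (a * d x) * (fact m * exp (a\<^sup>2 * real m ^ 3))"
      using Suc.hyps(1)[OF m] Suc.prems m by (intro mult_left_mono) auto
    finally show ?thesis .
  qed
  have "A \<noteq> {}" using Suc.hyps(2) by auto
  then have "(\<Sum>xs\<in>permutations_of_set A. exp (a * order_sum s xs)) =
      (\<Sum>x\<in>A. \<Sum>xs\<in>(#) x ` permutations_of_set (A - {x}). exp (a * order_sum s xs))"
    unfolding permutations_of_set_nonempty[OF \<open>A \<noteq> {}\<close>]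
    by (intro sum.UNION_disjoint) (use Suc.prems in auto)
  also have "\<dots> = (\<Sum>x\<in>A. \<Sum>xs\<in>permutations_of_set (A - {x}). exp (a * order_sum s (x # xs)))"
    by (rule sum.cong[OF refl], subst sum.reindex) auto
  also have "\<dots> \<le> (\<Sum>x\<in>A. exp (a * d x) * (fact m * exp (a\<^sup>2 * real m ^ 3)))"
    by (intro sum_mono rest)
  also have "\<dots> \<le> real (Suc m) * exp (a\<^sup>2 * real (Suc m) ^ 2) * (fact m * exp (a\<^sup>2 * real m ^ 3))"
    unfolding sum_distrib_right[symmetric] by (intro mult_right_mono first) simp
  also have "\<dots> = fact (Suc m) * exp (a\<^sup>2 * (real (Suc m) ^ 2 + real m ^ 3))"
    by (simp add: distrib_left exp_add mult_ac)
  also have "\<dots> \<le> fact (Suc m) * exp (a\<^sup>2 * real (Suc m) ^ 3)"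
  proof -
    \<comment> \<open>Each stripped element adds the square of the current size to the exponent; the
      cube absorbs these squares.\<close>
    have "real (Suc m) ^ 2 + real m ^ 3 \<le> real (Suc m) ^ 3"
      by (simp add: eval_nat_numeral algebra_simps)
    then show ?thesis by (simp add: mult_left_mono)
  qed
  finally show ?case using Suc.hyps(2) by simp
qed

lemma bij_betw_permutations_of_set:
  "bij_betw (\<lambda>\<pi>. map \<pi> [0..<n]) {\<pi>. \<pi> permutes {..<n}} (permutations_of_set {..<n})"
proof -
  have inj: "inj_on (\<lambda>\<pi>. map \<pi> [0..<n]) {\<pi>. \<pi> permutes {..<n}}"
  proof (rule inj_onI, rule ext)
    fix \<pi> \<rho> :: "nat \<Rightarrow> nat" and x
    assume *: "\<pi> \<in> {\<pi>. \<pi> permutes {..<n}}" "\<rho> \<in> {\<pi>. \<pi> permutes {..<n}}"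
      "map \<pi> [0..<n] = map \<rho> [0..<n]"
    show "\<pi> x = \<rho> x"
      by (cases "x < n") (use * in \<open>auto simp: permutes_not_in\<close>)
  qed
  have sub: "(\<lambda>\<pi>. map \<pi> [0..<n]) ` {\<pi>. \<pi> permutes {..<n}} \<subseteq> permutations_of_set {..<n}"
    by (auto simp: permutations_of_set_def distinct_map permutes_inj_on permutes_image
        lessThan_atLeast0[symmetric] dest: permutes_imp_bij)
  have "(\<lambda>\<pi>. map \<pi> [0..<n]) ` {\<pi>. \<pi> permutes {..<n}} = permutations_of_set {..<n}"
    by (rule card_subset_eq[OF _ sub]) (simp_all add: card_image[OF inj] card_permutations)
  then show ?thesis using inj by (simp add: bij_betw_def)
qed

lemma sum_exp_permutations:
  fixes s :: "nat \<Rightarrow> nat \<Rightarrow> real"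
  assumes "\<And>x y. s x y = - s y x" "\<And>x y. \<bar>s x y\<bar> \<le> 1"
  shows "(\<Sum>\<pi> | \<pi> permutes {..<n}. exp (a * (\<Sum>(i, j)\<in>pairs n. s (\<pi> i) (\<pi> j)))) \<le>
    fact n * exp (a\<^sup>2 * real n ^ 3)"
proof -
  have "(\<Sum>(i, j)\<in>pairs n. s (\<pi> i) (\<pi> j)) = order_sum s (map \<pi> [0..<n])" for \<pi>
    unfolding order_sum_nth pairs_def by (simp add: sum.Sigma[symmetric])
  then have "(\<Sum>\<pi> | \<pi> permutes {..<n}. exp (a * (\<Sum>(i, j)\<in>pairs n. s (\<pi> i) (\<pi> j)))) =
      (\<Sum>xs\<in>permutations_of_set {..<n}. exp (a * order_sum s xs))"
    by (simp add: sum.reindex_bij_betw[OF bij_betw_permutations_of_set,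
          where g = "\<lambda>xs. exp (a * order_sum s xs)", symmetric])
  also have "\<dots> \<le> fact n * exp (a\<^sup>2 * real n ^ 3)"
    using sum_exp_order_sum[OF _ assms, of "{..<n}" a] by simp
  finally show ?thesis .
qed

section \<open>Correlation of two rankings\<close>

definition rank_sgn :: "(nat \<Rightarrow> nat) \<Rightarrow> nat \<Rightarrow> nat \<Rightarrow> real" where
  "rank_sgn \<pi> i j = sgn (real (\<pi> j) - real (\<pi> i))"

lemma rank_sgn_skew: "rank_sgn \<pi> i j = - rank_sgn \<pi> j i"
  by (simp add: rank_sgn_def sgn_if)

lemma abs_rank_sgn_le: "\<bar>rank_sgn \<pi> i j\<bar> \<le> 1"
  by (simp add: rank_sgn_def sgn_if)

text \<open>Both factors are skew, so their product depends only on the unordered pair. Listing each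
  pair in the order of pi makes the first factor 1 and leaves s summed over the vertices sorted by
  rank.\<close>

lemma sum_pairs_rank_sgn:
  assumes "\<pi> permutes {..<n}" and skew: "\<And>x y. s x y = - s y x"
  shows "(\<Sum>(i, j)\<in>pairs n. rank_sgn \<pi> i j * s i j) = (\<Sum>(i, j)\<in>pairs n. s (inv \<pi> i) (inv \<pi> j))"
proof (rule sum.reindex_bij_witness[where
      i = "\<lambda>(i, j). if inv \<pi> i < inv \<pi> j then (inv \<pi> i, inv \<pi> j) else (inv \<pi> j, inv \<pi> i)" and
      j = "\<lambda>(i, j). if \<pi> i < \<pi> j then (\<pi> i, \<pi> j) else (\<pi> j, \<pi> i)"])
  have [simp]: "inv \<pi> (\<pi> x) = x" "\<pi> (inv \<pi> x) = x" for x
    using permutes_inverses[OF assms(1)] by auto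
  have [simp]: "\<pi> x < n \<longleftrightarrow> x < n" "inv \<pi> x < n \<longleftrightarrow> x < n" for x
    using permutes_in_image[OF assms(1)] permutes_in_image[OF permutes_inv[OF assms(1)]] by auto
  have neq: "\<pi> i \<noteq> \<pi> j" "inv \<pi> i \<noteq> inv \<pi> j" if "i \<noteq> j" for i j
    using that permutes_inj[OF assms(1)] permutes_inj[OF permutes_inv[OF assms(1)]] by (auto simp: inj_eq)
  fix p assume p: "p \<in> pairs n"
  obtain i j where ij: "p = (i, j)" "i < j" "j < n" using p by (auto simp: pairs_def)
  have *: "\<pi> i < \<pi> j \<or> \<pi> j < \<pi> i" "inv \<pi> i < inv \<pi> j \<or> inv \<pi> j < inv \<pi> i"
    using neq[of i j] ij by auto
  show "(case (case p of (i, j) \<Rightarrow> if \<pi> i < \<pi> j then (\<pi> i, \<pi> j) else (\<pi> j, \<pi> i)) of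
     (i, j) \<Rightarrow> if inv \<pi> i < inv \<pi> j then (inv \<pi> i, inv \<pi> j) else (inv \<pi> j, inv \<pi> i)) = p"
    using ij by auto
  show "(case p of (i, j) \<Rightarrow> if \<pi> i < \<pi> j then (\<pi> i, \<pi> j) else (\<pi> j, \<pi> i)) \<in> pairs n"
    using ij * by (auto simp: pairs_def)
  show "(case (case p of (i, j) \<Rightarrow> if inv \<pi> i < inv \<pi> j then (inv \<pi> i, inv \<pi> j) else (inv \<pi> j, inv \<pi> i)) of
     (i, j) \<Rightarrow> if \<pi> i < \<pi> j then (\<pi> i, \<pi> j) else (\<pi> j, \<pi> i)) = p"
    using ij by auto
  show "(case p of (i, j) \<Rightarrow> if inv \<pi> i < inv \<pi> j then (inv \<pi> i, inv \<pi> j) else (inv \<pi> j, inv \<pi> i)) \<in> pairs n"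
    using ij * by (auto simp: pairs_def)
  show "(case (case p of (i, j) \<Rightarrow> if \<pi> i < \<pi> j then (\<pi> i, \<pi> j) else (\<pi> j, \<pi> i)) of
     (i, j) \<Rightarrow> s (inv \<pi> i) (inv \<pi> j)) = (case p of (i, j) \<Rightarrow> rank_sgn \<pi> i j * s i j)"
    using ij * skew[of i j] by (auto simp: rank_sgn_def sgn_if)
qed

text \<open>The bound is uniform in the fixed ranking rho. Inversion is a bijection of the symmetric
  group, so the inverses from \<open>sum_pairs_rank_sgn\<close> can be replaced by the permutations
  themselves.\<close>

lemma sum_exp_rank_sgn:
  "(\<Sum>\<pi> | \<pi> permutes {..<n}. exp (a * (\<Sum>(i, j)\<in>pairs n. rank_sgn \<pi> i j * rank_sgn \<rho> i j))) \<le>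
    fact n * exp (a\<^sup>2 * real n ^ 3)"
proof -
  have "(\<Sum>\<pi> | \<pi> permutes {..<n}. exp (a * (\<Sum>(i, j)\<in>pairs n. rank_sgn \<pi> i j * rank_sgn \<rho> i j))) =
      (\<Sum>\<pi> | \<pi> permutes {..<n}. exp (a * (\<Sum>(i, j)\<in>pairs n. rank_sgn \<rho> (inv \<pi> i) (inv \<pi> j))))"
    by (intro sum.cong refl) (simp add: sum_pairs_rank_sgn[OF _ rank_sgn_skew])
  also have "\<dots> = (\<Sum>\<pi> | \<pi> permutes {..<n}. exp (a * (\<Sum>(i, j)\<in>pairs n. rank_sgn \<rho> (\<pi> i) (\<pi> j))))"
    by (rule sum_permutations_inverse[symmetric])
  also have "\<dots> \<le> fact n * exp (a\<^sup>2 * real n ^ 3)"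
    by (rule sum_exp_permutations) (rule rank_sgn_skew abs_rank_sgn_le)+
  finally show ?thesis .
qed

text \<open>Passing from \<open>ranked_pairs\<close> to \<open>pairs\<close> makes the index set
  independent of the ranking, so that the densities of two rankings can be multiplied factor by
  factor.\<close>

lemma pmf_planted_given:
  assumes \<pi>: "\<pi> permutes {..<n}" and T: "tournament n T" and \<gamma>: "0 \<le> \<gamma>" "\<gamma> \<le> 1 / 2"
  shows "pmf (planted_given n \<gamma> \<pi>) T =
    (\<Prod>(i, j)\<in>pairs n. 1 / 2 + \<gamma> * rank_sgn \<pi> i j * real_of_int (T i j))"
proof -
  let ?D = "PiE_dflt (ranked_pairs n \<pi>) False (\<lambda>_. UNIV :: bool set)"
  let ?P = "Pi_pmf (ranked_pairs n \<pi>) False (\<lambda>_. bernoulli_pmf (1 / 2 + \<gamma>))"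
  have inj: "inj_on (orient n \<pi>) ?D" and surj: "orient n \<pi> ` ?D = {T. tournament n T}"
    using bij_betw_orient[OF \<pi>] by (auto simp: bij_betw_def)
  obtain X where X: "X \<in> ?D" "T = orient n \<pi> X" using surj T by blast
  have sub: "set_pmf ?P \<subseteq> ?D"
    using set_Pi_pmf_subset[OF finite_ranked_pairs, of n \<pi> False "\<lambda>_. bernoulli_pmf (1 / 2 + \<gamma>)"]
    by (auto simp: PiE_dflt_def)
  have "pmf (planted_given n \<gamma> \<pi>) T = measure (measure_pmf ?P) (orient n \<pi> -` {T} \<inter> set_pmf ?P)"
    unfolding planted_given_def pmf_map by (rule measure_Int_set_pmf[symmetric])
  also have "orient n \<pi> -` {T} \<inter> set_pmf ?P = {X} \<inter> set_pmf ?P"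
    using X sub inj by (auto simp: inj_on_def)
  also have "measure (measure_pmf ?P) ({X} \<inter> set_pmf ?P) = pmf ?P X"
    by (simp only: measure_Int_set_pmf measure_pmf_single)
  also have "\<dots> = (\<Prod>e\<in>ranked_pairs n \<pi>. pmf (bernoulli_pmf (1 / 2 + \<gamma>)) (X e))"
    by (rule pmf_Pi') (use X(1) in \<open>auto simp: finite_ranked_pairs PiE_dflt_def\<close>)
  also have "\<dots> = (\<Prod>(i, j)\<in>ranked_pairs n \<pi>. 1 / 2 + \<gamma> * real_of_int (T i j))"
    using \<gamma> by (intro prod.cong refl) (auto simp: X(2) orient_def)
  also have "\<dots> = (\<Prod>(i, j)\<in>pairs n. 1 / 2 + \<gamma> * rank_sgn \<pi> i j * real_of_int (T i j))"
  proof (rule prod.reindex_bij_witness[where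
        i = "\<lambda>(i, j). if \<pi> i < \<pi> j then (i, j) else (j, i)" and
        j = "\<lambda>(i, j). if i < j then (i, j) else (j, i)"])
    have neq: "\<pi> i \<noteq> \<pi> j" if "i \<noteq> j" for i j
      using that permutes_inj[OF \<pi>] by (auto simp: inj_eq)
    have skew: "T i j = - T j i" if "i < n" "j < n" for i j
      using T that unfolding tournament_def by blast
    fix p
    {
      assume p: "p \<in> ranked_pairs n \<pi>"
      obtain i j where ij: "p = (i, j)" "i < n" "j < n" "\<pi> i < \<pi> j" "i \<noteq> j"
        using p by (auto simp: ranked_pairs_def)
      show "(case (case p of (i, j) \<Rightarrow> if i < j then (i, j) else (j, i)) of
          (i, j) \<Rightarrow> if \<pi> i < \<pi> j then (i, j) else (j, i)) = p"
        "(case p of (i, j) \<Rightarrow> if i < j then (i, j) else (j, i)) \<in> pairs n"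
        using ij by (auto simp: pairs_def)
      show "(case (case p of (i, j) \<Rightarrow> if i < j then (i, j) else (j, i)) of
          (i, j) \<Rightarrow> 1 / 2 + \<gamma> * rank_sgn \<pi> i j * real_of_int (T i j)) =
          (case p of (i, j) \<Rightarrow> 1 / 2 + \<gamma> * real_of_int (T i j))"
        using ij skew[of i j] by (auto simp: rank_sgn_def sgn_if)
    next
      assume p: "p \<in> pairs n"
      obtain i j where ij: "p = (i, j)" "i < n" "j < n" "i < j" "\<pi> i < \<pi> j \<or> \<pi> j < \<pi> i"
        using p neq[of "fst p" "snd p"] by (cases p) (auto simp: pairs_def nat_neq_iff)
      show "(case (case p of (i, j) \<Rightarrow> if \<pi> i < \<pi> j then (i, j) else (j, i)) of
          (i, j) \<Rightarrow> if i < j then (i, j) else (j, i)) = p"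
        "(case p of (i, j) \<Rightarrow> if \<pi> i < \<pi> j then (i, j) else (j, i)) \<in> ranked_pairs n \<pi>"
        using ij by (auto simp: ranked_pairs_def)
    }
  qed
  finally show ?thesis .
qed

section \<open>Sums over all tournaments and the likelihood ratio\<close>

lemma finite_tournaments: "finite {T. tournament n T}"
proof -
  have "finite (PiE_dflt (ranked_pairs n id) False (\<lambda>_. UNIV :: bool set))"
    by (intro finite_PiE_dflt finite_ranked_pairs) auto
  then show ?thesis
    using bij_betw_finite[OF bij_betw_orient[OF permutes_id]] by blast
qed

lemma set_pmf_planted_given:
  assumes "\<pi> permutes {..<n}"
  shows "set_pmf (planted_given n \<gamma> \<pi>) \<subseteq> {T. tournament n T}"
  unfolding planted_given_def using tournament_orient[OF assms] by auto

lemma set_pmf_planted_model: "set_pmf (planted_model n \<gamma>) \<subseteq> {T. tournament n T}"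
proof -
  have "{\<pi>. \<pi> permutes {..<n}} \<noteq> {}" using permutes_id by blast
  then show ?thesis
    unfolding planted_model_def
    by (auto simp: finite_permutations dest: set_pmf_planted_given[THEN subsetD])
qed

text \<open>Up to the constant weight of a tournament, the sum is an expectation for the identity
  ranking and gamma = 0, where the entries are independent fair signs.\<close>

lemma sum_tournaments_prod:
  fixes g :: "nat \<Rightarrow> nat \<Rightarrow> int \<Rightarrow> real"
  shows "(\<Sum>T | tournament n T. \<Prod>(i, j)\<in>pairs n. g i j (T i j)) =
    (\<Prod>(i, j)\<in>pairs n. g i j 1 + g i j (-1))"
proof -
  let ?h = "\<lambda>T. \<Prod>(i, j)\<in>pairs n. g i j (T i j)"
  have rp: "ranked_pairs n id = pairs n" by (auto simp: ranked_pairs_def pairs_def)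
  have "(1 / 2) ^ card (pairs n) * (\<Sum>T | tournament n T. ?h T) =
      measure_pmf.expectation (planted_given n 0 id) ?h"
    unfolding sum_distrib_left
    by (subst integral_measure_pmf[OF finite_tournaments])
      (use set_pmf_planted_given[OF permutes_id] in
        \<open>auto simp: pmf_planted_given[OF permutes_id] intro!: sum.cong\<close>)
  also have "\<dots> = measure_pmf.expectation (Pi_pmf (pairs n) False (\<lambda>_. bernoulli_pmf (1 / 2)))
      (\<lambda>X. \<Prod>e\<in>pairs n. (case e of (i, j) \<Rightarrow> \<lambda>b. g i j (if b then 1 else -1)) (X e))"
    unfolding planted_given_def integral_map_pmf rp
    by (intro Bochner_Integration.integral_cong prod.cong) (auto simp: orient_def rp)
  also have "\<dots> = (\<Prod>e\<in>pairs n. measure_pmf.expectation (bernoulli_pmf (1 / 2))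
      (case e of (i, j) \<Rightarrow> \<lambda>b. g i j (if b then 1 else -1)))"
    by (rule expectation_prod_Pi_pmf_finite) (auto simp: finite_pairs)
  also have "\<dots> = (\<Prod>e\<in>pairs n. (1 / 2) * (case e of (i, j) \<Rightarrow> g i j 1 + g i j (-1)))"
    by (intro prod.cong refl) (auto simp: field_simps)
  also have "\<dots> = (1 / 2) ^ card (pairs n) * (\<Prod>(i, j)\<in>pairs n. g i j 1 + g i j (-1))"
    by (simp add: prod_dividef power_divide)
  finally show ?thesis by simp
qed

lemma card_tournaments: "real (card {T. tournament n T}) = 2 ^ card (pairs n)"
  using sum_tournaments_prod[where g = "\<lambda>_ _ _. 1"] by (simp add: case_prod_unfold)

text \<open>For one pair, (1/2 + gamma sigma t) (1/2 + gamma sigma' t) summed over t = 1, -1 is (1 +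
  4 gamma^2 sigma sigma') / 2; the number of tournaments cancels the halves.\<close>

lemma sum_planted_given_mult:
  assumes "\<pi> permutes {..<n}" "\<rho> permutes {..<n}" and \<gamma>: "0 \<le> \<gamma>" "\<gamma> \<le> 1 / 2"
  shows "card {T. tournament n T} * (\<Sum>T | tournament n T. pmf (planted_given n \<gamma> \<pi>) T * pmf (planted_given n \<gamma> \<rho>) T) =
    (\<Prod>(i, j)\<in>pairs n. 1 + 4 * \<gamma>\<^sup>2 * (rank_sgn \<pi> i j * rank_sgn \<rho> i j))"
proof -
  have "(\<Sum>T | tournament n T. pmf (planted_given n \<gamma> \<pi>) T * pmf (planted_given n \<gamma> \<rho>) T) =
    (\<Sum>T | tournament n T. \<Prod>(i, j)\<in>pairs n.
      (1 / 2 + \<gamma> * rank_sgn \<pi> i j * real_of_int (T i j)) * (1 / 2 + \<gamma> * rank_sgn \<rho> i j * real_of_int (T i j)))"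
    by (intro sum.cong refl)
      (simp add: pmf_planted_given[OF assms(1) _ \<gamma>] pmf_planted_given[OF assms(2) _ \<gamma>]
        prod.distrib[symmetric] case_prod_unfold)
  also have "\<dots> = (\<Prod>(i, j)\<in>pairs n. (1 / 2) * (1 + 4 * \<gamma>\<^sup>2 * (rank_sgn \<pi> i j * rank_sgn \<rho> i j)))"
    unfolding sum_tournaments_prod[where g = "\<lambda>i j t. (1 / 2 + \<gamma> * rank_sgn \<pi> i j * real_of_int t) *
        (1 / 2 + \<gamma> * rank_sgn \<rho> i j * real_of_int t)"]
    by (intro prod.cong refl) (auto simp: field_simps power2_eq_square)
  finally show ?thesis
    by (simp add: card_tournaments prod_dividef case_prod_unfold)
qed

lemma pmf_planted_model:
  "pmf (planted_model n \<gamma>) T = (\<Sum>\<pi> | \<pi> permutes {..<n}. pmf (planted_given n \<gamma> \<pi>) T) / fact n"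
proof -
  have "{\<pi>. \<pi> permutes {..<n}} \<noteq> {}" using permutes_id by blast
  then show ?thesis
    unfolding planted_model_def pmf_bind
    by (subst integral_pmf_of_set) (auto simp: finite_permutations card_permutations)
qed

text \<open>The null density is 1 / card, so the left side is the null expectation of the squared
  likelihood ratio. The exponent is a^2 n^3 for a = 4 gamma^2.\<close>

lemma second_moment:
  assumes \<gamma>: "0 \<le> \<gamma>" "\<gamma> \<le> 1 / 2"
  shows "card {T. tournament n T} * (\<Sum>T | tournament n T. (pmf (planted_model n \<gamma>) T)\<^sup>2) \<le>
    exp (16 * \<gamma> ^ 4 * real n ^ 3)"
proof -
  let ?S = "{\<pi>. \<pi> permutes {..<n}}" and ?N = "real (card {T. tournament n T})"
  let ?p = "\<lambda>\<pi>. pmf (planted_given n \<gamma> \<pi>)"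
  have eq: "?N * (\<Sum>T | tournament n T. (pmf (planted_model n \<gamma>) T)\<^sup>2) =
      ?N * (\<Sum>T | tournament n T. \<Sum>\<rho>\<in>?S. \<Sum>\<pi>\<in>?S. ?p \<rho> T * ?p \<pi> T) / (fact n)\<^sup>2"
    by (simp add: pmf_planted_model power_divide sum_divide_distrib[symmetric])
      (simp add: power2_eq_square sum_product)
  have "(\<Sum>T | tournament n T. \<Sum>\<rho>\<in>?S. \<Sum>\<pi>\<in>?S. ?p \<rho> T * ?p \<pi> T) =
      (\<Sum>\<rho>\<in>?S. \<Sum>\<pi>\<in>?S. \<Sum>T | tournament n T. ?p \<pi> T * ?p \<rho> T)"
    by (subst sum.swap, intro sum.cong refl, subst sum.swap) (simp add: mult.commute)
  then have "?N * (\<Sum>T | tournament n T. \<Sum>\<rho>\<in>?S. \<Sum>\<pi>\<in>?S. ?p \<rho> T * ?p \<pi> T) = (\<Sum>\<rho>\<in>?S. \<Sum>\<pi>\<in>?S. ?N * (\<Sum>T | tournament n T. ?p \<pi> T * ?p \<rho> T))"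
    by (simp add: sum_distrib_left)
  also have "\<dots> = (\<Sum>\<rho>\<in>?S. \<Sum>\<pi>\<in>?S. \<Prod>(i, j)\<in>pairs n. 1 + 4 * \<gamma>\<^sup>2 * (rank_sgn \<pi> i j * rank_sgn \<rho> i j))"
    by (intro sum.cong refl sum_planted_given_mult \<gamma>) auto
  also have "\<dots> \<le> (\<Sum>\<rho>\<in>?S. \<Sum>\<pi>\<in>?S. exp (4 * \<gamma>\<^sup>2 * (\<Sum>(i, j)\<in>pairs n. rank_sgn \<pi> i j * rank_sgn \<rho> i j)))"
  proof (intro sum_mono)
    fix \<rho> \<pi>
    \<comment> \<open>Keeps every factor nonnegative, so that the product can be bounded
      factorwise.\<close>
    have "4 * \<gamma>\<^sup>2 \<le> 1" using power_mono[OF \<gamma>(2,1), of 2] by (simp add: power_divide)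
    have "(\<Prod>(i, j)\<in>pairs n. 1 + 4 * \<gamma>\<^sup>2 * (rank_sgn \<pi> i j * rank_sgn \<rho> i j)) \<le>
        (\<Prod>(i, j)\<in>pairs n. exp (4 * \<gamma>\<^sup>2 * (rank_sgn \<pi> i j * rank_sgn \<rho> i j)))"
    proof (intro prod_mono, clarify, intro conjI)
      fix i j
      have "\<bar>rank_sgn \<pi> i j * rank_sgn \<rho> i j\<bar> \<le> 1"
        by (simp add: abs_mult mult_le_one abs_rank_sgn_le)
      then have "\<bar>4 * \<gamma>\<^sup>2 * (rank_sgn \<pi> i j * rank_sgn \<rho> i j)\<bar> \<le> 1"
        using \<open>4 * \<gamma>\<^sup>2 \<le> 1\<close> by (simp only: abs_mult[of "4 * \<gamma>\<^sup>2"]) (auto intro: mult_le_one)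
      then show "0 \<le> 1 + 4 * \<gamma>\<^sup>2 * (rank_sgn \<pi> i j * rank_sgn \<rho> i j)" by linarith
      show "1 + 4 * \<gamma>\<^sup>2 * (rank_sgn \<pi> i j * rank_sgn \<rho> i j) \<le> exp (4 * \<gamma>\<^sup>2 * (rank_sgn \<pi> i j * rank_sgn \<rho> i j))"
        by (rule exp_ge_add_one_self)
    qed
    also have "\<dots> = exp (4 * \<gamma>\<^sup>2 * (\<Sum>(i, j)\<in>pairs n. rank_sgn \<pi> i j * rank_sgn \<rho> i j))"
      by (simp add: exp_sum finite_pairs sum_distrib_left case_prod_unfold)
    finally show "(\<Prod>(i, j)\<in>pairs n. 1 + 4 * \<gamma>\<^sup>2 * (rank_sgn \<pi> i j * rank_sgn \<rho> i j)) \<le>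
        exp (4 * \<gamma>\<^sup>2 * (\<Sum>(i, j)\<in>pairs n. rank_sgn \<pi> i j * rank_sgn \<rho> i j))" .
  qed
  also have "\<dots> \<le> (\<Sum>\<rho>\<in>?S. fact n * exp ((4 * \<gamma>\<^sup>2)\<^sup>2 * real n ^ 3))"
    by (rule sum_mono, rule sum_exp_rank_sgn)
  also have "\<dots> = (fact n)\<^sup>2 * exp (16 * \<gamma> ^ 4 * real n ^ 3)"
  proof -
    have "(4 * \<gamma>\<^sup>2)\<^sup>2 = 16 * \<gamma> ^ 4" by (simp add: power_mult_distrib flip: power_mult)
    then show ?thesis by (simp add: card_permutations power2_eq_square[of "fact n"])
  qed
  finally show ?thesis unfolding eq by (simp add: divide_le_eq mult.commute)
qed

text \<open>One minus the error is the sum of (p - 1 / N) a, with a the acceptance probability.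
  Cauchy-Schwarz produces the chi-square divergence, and a^2 <= a turns the second factor into the
  null acceptance probability.\<close>

lemma detection_error_lower:
  assumes \<gamma>: "0 \<le> \<gamma> n" "\<gamma> n \<le> 1 / 2"
  shows "(1 - detection_error \<gamma> A n)\<^sup>2 \<le>
    (exp (16 * \<gamma> n ^ 4 * real n ^ 3) - 1) * pmf (bind_pmf (null_model n) (A n)) True"
proof -
  let ?T = "{T. tournament n T}"
  define N where "N = real (card ?T)"
  define a where "a T = pmf (A n T) True" for T
  define p where "p T = pmf (planted_model n (\<gamma> n)) T" for T
  have N: "N > 0" by (simp add: N_def card_tournaments)
  have ne: "?T \<noteq> {}" using N unfolding N_def by (metis card.empty less_irrefl of_nat_0)
  have q: "pmf (bind_pmf (null_model n) (A n)) True = (\<Sum>T\<in>?T. a T) / N"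
    unfolding null_model_uniform pmf_bind
    by (subst integral_pmf_of_set[OF ne finite_tournaments]) (simp add: a_def N_def)
  have pmf_False: "pmf (A n T) False = 1 - a T" for T
    unfolding a_def by (rule pmf_False_conv_True)
  have "pmf (bind_pmf (planted_model n (\<gamma> n)) (A n)) False = (\<Sum>T\<in>?T. p T * (1 - a T))"
    unfolding pmf_bind pmf_False
    by (subst integral_measure_pmf[OF finite_tournaments])
      (use set_pmf_planted_model in \<open>auto simp: p_def\<close>)
  moreover have sum_p: "(\<Sum>T\<in>?T. p T) = 1"
    unfolding p_def by (rule sum_pmf_eq_1[OF finite_tournaments set_pmf_planted_model])
  ultimately have err: "1 - detection_error \<gamma> A n = (\<Sum>T\<in>?T. (p T - 1 / N) * a T)"
    unfolding detection_error_def q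
    by (simp add: algebra_simps sum_subtractf sum_divide_distrib)
  have "(\<Sum>T\<in>?T. (p T - 1 / N) * a T)\<^sup>2 \<le> (\<Sum>T\<in>?T. (p T - 1 / N)\<^sup>2) * (\<Sum>T\<in>?T. (a T)\<^sup>2)"
    by (rule Cauchy_Schwarz_ineq_sum)
  also have "\<dots> \<le> (\<Sum>T\<in>?T. (p T - 1 / N)\<^sup>2) * (\<Sum>T\<in>?T. a T)"
    by (intro mult_left_mono sum_mono sum_nonneg)
      (auto simp: a_def power2_eq_square pmf_le_1 mult_left_le)
  also have "(\<Sum>T\<in>?T. (p T - 1 / N)\<^sup>2) = (\<Sum>T\<in>?T. (p T)\<^sup>2) - 1 / N"
  proof -
    have "(\<Sum>T\<in>?T. (p T - 1 / N)\<^sup>2) = (\<Sum>T\<in>?T. (p T)\<^sup>2) - (2 / N) * (\<Sum>T\<in>?T. p T) + N * (1 / N)\<^sup>2"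
      by (simp add: power2_diff sum.distrib sum_subtractf sum_distrib_left sum_divide_distrib N_def mult_ac)
    then show ?thesis unfolding sum_p using N by (simp add: power2_eq_square field_simps)
  qed
  also have "\<dots> * (\<Sum>T\<in>?T. a T) = (N * (\<Sum>T\<in>?T. (p T)\<^sup>2) - 1) * ((\<Sum>T\<in>?T. a T) / N)"
    using N by (simp add: field_simps)
  also have "\<dots> \<le> (exp (16 * \<gamma> n ^ 4 * real n ^ 3) - 1) * ((\<Sum>T\<in>?T. a T) / N)"
    using second_moment[OF \<gamma>] N
    by (intro mult_right_mono divide_nonneg_pos sum_nonneg) (auto simp: N_def p_def a_def)
  finally show ?thesis unfolding err q .
qed

text \<open>The exponential is bounded by a constant K, so the error e satisfies (1 - e)^2 <= K e,
  which is impossible in the limit e = 0.\<close>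

lemma no_strong_detection:
  assumes \<gamma>: "\<And>n. 0 \<le> \<gamma> n \<and> \<gamma> n \<le> 1 / 2" and O: "\<gamma> \<in> O(\<lambda>n. real n powr (- (3 / 4)))"
  shows "\<not> strong_detection \<gamma> A"
proof
  assume "strong_detection \<gamma> A"
  then have lim: "detection_error \<gamma> A \<longlonglongrightarrow> 0" by (simp add: strong_detection_def)
  obtain C where C: "C > 0" "eventually (\<lambda>n. norm (\<gamma> n) \<le> C * norm (real n powr (- (3 / 4)))) sequentially"
    using landau_o.bigE[OF O] by blast
  let ?K = "exp (16 * C ^ 4)"
  have "eventually (\<lambda>n. (1 - detection_error \<gamma> A n)\<^sup>2 \<le> ?K * detection_error \<gamma> A n) sequentially"
    using C(2) eventually_gt_at_top[of 0]
  proof eventually_elim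
    case (elim n)
    let ?q = "pmf (bind_pmf (null_model n) (A n)) True"
    have "\<gamma> n ^ 4 \<le> (C * real n powr (- (3 / 4))) ^ 4"
      using elim \<gamma>[of n] by (intro power_mono) auto
    also have "\<dots> = C ^ 4 * real n powr (- 3)"
      using elim by (simp add: power_mult_distrib powr_power)
    finally have "\<gamma> n ^ 4 * real n ^ 3 \<le> C ^ 4 * real n powr (- 3) * real n ^ 3"
      by (rule mult_right_mono) simp
    also have "\<dots> = C ^ 4"
      using elim by (simp add: powr_minus powr_numeral field_simps)
    finally have "exp (16 * \<gamma> n ^ 4 * real n ^ 3) \<le> ?K" by (simp add: mult.assoc)
    then have "exp (16 * \<gamma> n ^ 4 * real n ^ 3) - 1 \<le> ?K" by linarith
    then have "(exp (16 * \<gamma> n ^ 4 * real n ^ 3) - 1) * ?q \<le> ?K * ?q"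
      by (rule mult_right_mono) simp
    also have "\<dots> \<le> ?K * detection_error \<gamma> A n"
      by (simp add: detection_error_def)
    finally show ?case using detection_error_lower[of \<gamma> n A] \<gamma>[of n] by linarith
  qed
  moreover have "(\<lambda>n. (1 - detection_error \<gamma> A n)\<^sup>2) \<longlonglongrightarrow> (1 - 0)\<^sup>2"
    by (intro tendsto_intros lim)
  moreover have "(\<lambda>n. ?K * detection_error \<gamma> A n) \<longlonglongrightarrow> ?K * 0"
    by (intro tendsto_intros lim)
  ultimately have "(1 - 0)\<^sup>2 \<le> ?K * (0 :: real)"
    using tendsto_le[OF sequentially_bot] by blast
  then show False by simp
qed

text \<open>Now the chi-square factor itself tends to 0, so the error of every test tends to
  1.\<close>

lemma no_weak_detection:
  assumes \<gamma>: "\<And>n. 0 \<le> \<gamma> n \<and> \<gamma> n \<le> 1 / 2" and o: "\<gamma> \<in> o(\<lambda>n. real n powr (- (3 / 4)))"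
  shows "\<not> weak_detection \<gamma> A"
proof
  assume "weak_detection \<gamma> A"
  then obtain \<delta> where \<delta>: "\<delta> > 0" "limsup (\<lambda>n. ereal (detection_error \<gamma> A n)) \<le> ereal (1 - \<delta>)"
    by (auto simp: weak_detection_def)
  have "(\<lambda>n. \<gamma> n / real n powr (- (3 / 4))) \<longlonglongrightarrow> 0"
    using o by (rule smalloD_tendsto)
  then have "(\<lambda>n. (\<gamma> n / real n powr (- (3 / 4))) ^ 4) \<longlonglongrightarrow> 0 ^ 4"
    by (rule tendsto_power)
  moreover have "(\<gamma> n / real n powr (- (3 / 4))) ^ 4 = \<gamma> n ^ 4 * real n ^ 3" for n
  proof (cases "n = 0")
    case False
    then show ?thesis
      by (simp add: power_divide powr_power powr_minus powr_numeral field_simps)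
  qed simp
  ultimately have "(\<lambda>n. \<gamma> n ^ 4 * real n ^ 3) \<longlonglongrightarrow> 0" by simp
  then have "(\<lambda>n. exp (16 * (\<gamma> n ^ 4 * real n ^ 3)) - 1) \<longlonglongrightarrow> exp (16 * 0) - 1"
    by (intro tendsto_intros)
  then have lim: "(\<lambda>n. exp (16 * \<gamma> n ^ 4 * real n ^ 3) - 1) \<longlonglongrightarrow> 0" by (simp add: mult.assoc)
  have "(\<lambda>n. (1 - detection_error \<gamma> A n)\<^sup>2) \<longlonglongrightarrow> 0"
  proof (rule tendsto_sandwich[OF _ _ tendsto_const lim])
    show "eventually (\<lambda>n. (1 - detection_error \<gamma> A n)\<^sup>2 \<le> exp (16 * \<gamma> n ^ 4 * real n ^ 3) - 1) sequentially"
    proof (intro always_eventually allI)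
      fix n
      have "0 \<le> exp (16 * \<gamma> n ^ 4 * real n ^ 3) - 1" by simp
      from mult_left_le[OF pmf_le_1 this] detection_error_lower[of \<gamma> n A] \<gamma>[of n]
      show "(1 - detection_error \<gamma> A n)\<^sup>2 \<le> exp (16 * \<gamma> n ^ 4 * real n ^ 3) - 1"
        by (meson order.trans)
    qed
  qed simp
  then have "(\<lambda>n. sqrt ((1 - detection_error \<gamma> A n)\<^sup>2)) \<longlonglongrightarrow> sqrt 0"
    by (rule tendsto_real_sqrt)
  then have "(\<lambda>n. 1 - detection_error \<gamma> A n) \<longlonglongrightarrow> 0"
    by (simp add: tendsto_rabs_zero_iff)
  then have "detection_error \<gamma> A \<longlonglongrightarrow> 1"
    using tendsto_diff[OF tendsto_const[of 1], of "\<lambda>n. 1 - detection_error \<gamma> A n" 0] by simp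
  then have "(\<lambda>n. ereal (detection_error \<gamma> A n)) \<longlonglongrightarrow> ereal 1" by simp
  then have "limsup (\<lambda>n. ereal (detection_error \<gamma> A n)) = ereal 1"
    by (rule lim_imp_Limsup[OF sequentially_bot])
  then show False using \<delta> by simp
qed

section \<open>Error of the degree test\<close>

lemma sum_row_outdegree:
  assumes T: "tournament n T" and i: "i < n"
  shows "(\<Sum>j<n. real_of_int (T i j)) = 2 * real (outdegree n T i) - (real n - 1)"
proof -
  have row: "real_of_int (T i j) = (if T i j = 1 then 2 else 0) - 1 + (if j = i then 1 else 0)"
    if "j \<in> {..<n}" for j
  proof (cases "j = i")
    case True
    have "T i i = - T i i" using T i unfolding tournament_def by blast
    then show ?thesis using True by simp
  next
    case False
    then have "T i j \<in> {1, -1}" using T i that unfolding tournament_def by blast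
    then show ?thesis using False by auto
  qed
  have "(\<Sum>j<n. real_of_int (T i j)) =
      (\<Sum>j<n. (if T i j = 1 then 2 else 0) - 1 + (if j = i then 1 else 0))"
    by (rule sum.cong[OF refl row])
  also have "\<dots> = (\<Sum>j<n. if T i j = 1 then 2 else 0) - real n + (\<Sum>j<n. if j = i then 1 else 0)"
    by (simp add: sum.distrib sum_subtractf)
  also have "(\<Sum>j<n. if T i j = 1 then 2 else 0) = 2 * real (card ({..<n} \<inter> {j. T i j = 1}))"
    by (simp add: sum.If_cases)
  also have "{..<n} \<inter> {j. T i j = 1} = {j. j < n \<and> T i j = 1}" by auto
  finally show ?thesis using i by (simp add: outdegree_def)
qed

text \<open>By skew symmetry the row sums add up to 0, which fixes the sum of the outdegrees at n (n
  - 1) / 2; only the sum of their squares remains free.\<close>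

lemma wedge_sum_outdegree:
  assumes T: "tournament n T"
  shows "wedge_sum n T = 4 * (\<Sum>i<n. (real (outdegree n T i))\<^sup>2) - (real n)\<^sup>2 * (real n - 1)"
proof -
  let ?d = "\<lambda>i. real (outdegree n T i)"
  have skew: "T i j = - T j i" if "i < n" "j < n" for i j
    using T that unfolding tournament_def by blast
  have "(\<Sum>i<n. \<Sum>j<n. real_of_int (T i j)) = (\<Sum>j<n. \<Sum>i<n. real_of_int (T i j))"
    by (rule sum.swap)
  also have "\<dots> = (\<Sum>j<n. \<Sum>i<n. - real_of_int (T j i))"
    by (intro sum.cong refl) (metis lessThan_iff of_int_minus skew)
  finally have "(\<Sum>i<n. \<Sum>j<n. real_of_int (T i j)) = 0"
    by (simp add: sum_negf)
  then have "(\<Sum>i<n. 2 * ?d i - (real n - 1)) = 0"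
    by (simp add: sum_row_outdegree[OF T])
  then have d: "2 * (\<Sum>i<n. ?d i) = real n * (real n - 1)"
    by (simp add: sum_subtractf sum_distrib_left)
  have "(real_of_int (T i j))\<^sup>2 = 1" if "i < n" "j < n" "i \<noteq> j" for i j
  proof -
    have "T i j \<in> {1, -1}" using T that unfolding tournament_def by blast
    then show ?thesis by auto
  qed
  moreover have "real_of_int (T i i) = 0" if "i < n" for i
    using skew[OF that that] by simp
  ultimately have "wedge_sum n T = (\<Sum>i<n. (\<Sum>j<n. real_of_int (T i j))\<^sup>2) - real n * (real n - 1)"
    unfolding wedge_sum_def by (intro sum_wedges)
  also have "(\<Sum>i<n. (\<Sum>j<n. real_of_int (T i j))\<^sup>2) = (\<Sum>i<n. (2 * ?d i - (real n - 1))\<^sup>2)"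
    by (simp add: sum_row_outdegree[OF T])
  also have "\<dots> = (\<Sum>i<n. 4 * (?d i)\<^sup>2 - 2 * (real n - 1) * (2 * ?d i) + (real n - 1)\<^sup>2)"
    by (intro sum.cong refl) (simp add: power2_eq_square algebra_simps)
  also have "\<dots> = 4 * (\<Sum>i<n. (?d i)\<^sup>2) - 2 * (real n - 1) * (2 * (\<Sum>i<n. ?d i)) + real n * (real n - 1)\<^sup>2"
    by (simp add: sum.distrib sum_subtractf sum_distrib_left)
  finally show ?thesis unfolding d by (simp add: power2_eq_square algebra_simps)
qed

lemma degree_test_wedge_sum:
  assumes "tournament n T"
  shows "degree_test b n T = return_pmf (real n * real (b n) \<le> 2 * wedge_sum n T)"
proof -
  have "n * b n + 2 * (n - 1) * n\<^sup>2 \<le> 8 * (\<Sum>i<n. (outdegree n T i)\<^sup>2) \<longleftrightarrow>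
      real (n * b n + 2 * (n - 1) * n\<^sup>2) \<le> real (8 * (\<Sum>i<n. (outdegree n T i)\<^sup>2))"
    by (rule of_nat_le_iff[symmetric])
  \<comment> \<open>The case distinction handles the truncated \<open>n - 1\<close> at n =
    0.\<close>
  also have "\<dots> \<longleftrightarrow> real n * real (b n) \<le> 2 * wedge_sum n T"
    unfolding wedge_sum_outdegree[OF assms]
    by (cases n) (simp_all add: algebra_simps)
  finally show ?thesis by (simp add: degree_test_def)
qed

section \<open>Chebyshev bounds and the two positive results\<close>

definition wedge_mean :: "nat \<Rightarrow> real \<Rightarrow> real" where
  "wedge_mean n \<gamma> = 4 * \<gamma>\<^sup>2 * (real n * (real n - 1) * (real n - 2) / 3)"

text \<open>Chebyshev's inequality for a test with random output. Mean and variance bound are the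
  same for all rankings, so averaging over the ranking adds no variance.\<close>

lemma pmf_bind_planted_model_le:
  fixes A :: "tmatrix \<Rightarrow> bool pmf"
  assumes \<gamma>: "0 \<le> \<gamma>" "\<gamma> \<le> 1 / 2"
    and A: "\<And>T. tournament n T \<Longrightarrow> pmf (A T) x \<le> (wedge_sum n T - wedge_mean n \<gamma>)\<^sup>2 / c"
    and c: "c > 0"
  shows "pmf (bind_pmf (planted_model n \<gamma>) A) x \<le> (6 * real n ^ 3 + 48 * \<gamma>\<^sup>2 * real n ^ 4) / c"
proof -
  let ?S = "{\<pi>. \<pi> permutes {..<n}}" and ?g = "\<lambda>T. (wedge_sum n T - wedge_mean n \<gamma>)\<^sup>2"
  let ?V = "6 * real n ^ 3 + 48 * \<gamma>\<^sup>2 * real n ^ 4"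
  have ne: "?S \<noteq> {}" using permutes_id by blast
  have fin: "finite ?S" by (simp add: finite_permutations)
  have int: "integrable (measure_pmf (planted_model n \<gamma>)) f" for f :: "tmatrix \<Rightarrow> real"
    by (rule integrable_measure_pmf_finite)
      (rule finite_subset[OF set_pmf_planted_model finite_tournaments])
  have given: "measure_pmf.expectation (planted_given n \<gamma> \<pi>) ?g \<le> ?V" if "\<pi> \<in> ?S" for \<pi>
    unfolding wedge_mean_def by (rule expectation_wedge_sum[OF _ \<gamma>]) (use that in simp)
  have "measure_pmf.expectation (planted_model n \<gamma>) ?g =
      (\<Sum>\<pi>\<in>?S. pmf (pmf_of_set ?S) \<pi> *\<^sub>R measure_pmf.expectation (planted_given n \<gamma> \<pi>) ?g)"
    unfolding planted_model_def
    by (rule pmf_expectation_bind)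
      (auto simp: fin set_pmf_of_set[OF ne fin] intro: finite_subset[OF set_pmf_planted_given finite_tournaments])
  also have "\<dots> \<le> (\<Sum>\<pi>\<in>?S. pmf (pmf_of_set ?S) \<pi> *\<^sub>R ?V)"
    by (intro sum_mono scaleR_left_mono given) auto
  also have "\<dots> = ?V"
    using sum_pmf_eq_1[OF fin, of "pmf_of_set ?S"] fin ne
    by (simp add: scaleR_left.sum[symmetric])
  finally have V: "measure_pmf.expectation (planted_model n \<gamma>) ?g \<le> ?V" .
  have "pmf (bind_pmf (planted_model n \<gamma>) A) x \<le> measure_pmf.expectation (planted_model n \<gamma>) (\<lambda>T. ?g T / c)"
    unfolding pmf_bind using set_pmf_planted_model A
    by (intro integral_mono_AE int) (auto simp: AE_measure_pmf_iff)
  also have "\<dots> = measure_pmf.expectation (planted_model n \<gamma>) ?g / c" by simp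
  also have "\<dots> \<le> ?V / c" using V c by (intro divide_right_mono) auto
  finally show ?thesis .
qed

text \<open>The threshold n b / 2 has that distance from the null mean 0, and by \<open>thr\<close>
  at least the distance gamma^2 n^3 / 2 from the planted mean. The first term is the null error; the
  other two come from the two parts of the planted variance bound.\<close>

lemma detection_error_degree_test:
  assumes \<gamma>: "0 < \<gamma> n" "\<gamma> n \<le> 1 / 2" and n: "n \<ge> 12" and b: "b n > 0"
    and thr: "real n * real (b n) \<le> (\<gamma> n)\<^sup>2 * real n ^ 3"
  shows "detection_error \<gamma> (degree_test b) n \<le>
    24 * real n / (real (b n))\<^sup>2 + 24 / (\<gamma> n ^ 4 * real n ^ 3) + 192 / (\<gamma> n * real n)\<^sup>2"
proof -
  let ?g = "\<gamma> n" and ?t = "real n * real (b n) / 2" and ?s = "(\<gamma> n)\<^sup>2 * real n ^ 3 / 2"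
  have pos: "?t > 0" "?s > 0" using n b \<gamma> by auto
  have "pmf (bind_pmf (planted_model n 0) (degree_test b n)) True \<le>
      (6 * real n ^ 3 + 48 * 0\<^sup>2 * real n ^ 4) / ?t\<^sup>2"
  proof (rule pmf_bind_planted_model_le)
    fix T assume T: "tournament n T"
    have "1 \<le> (wedge_sum n T)\<^sup>2 / ?t\<^sup>2" if "?t \<le> wedge_sum n T"
      using power_mono[OF that, of 2] pos by (simp only: le_divide_eq_1_pos zero_less_power)
    then show "pmf (degree_test b n T) True \<le> (wedge_sum n T - wedge_mean n 0)\<^sup>2 / ?t\<^sup>2"
      by (auto simp: degree_test_wedge_sum[OF T] wedge_mean_def indicator_def)
  qed (use pos n b in auto)
  also have "\<dots> = 24 * real n / (real (b n))\<^sup>2"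
    using n b by (simp add: field_simps eval_nat_numeral)
  finally have 1: "pmf (bind_pmf (null_model n) (degree_test b n)) True \<le> 24 * real n / (real (b n))\<^sup>2"
    by (simp add: null_model_def)
  have mean: "2 * ?s \<le> wedge_mean n ?g"
  proof -
    \<comment> \<open>n >= 12 makes (n - 1) (n - 2) at least 3/4 of n^2, so the planted mean is at
      least gamma^2 n^3.\<close>
    have "12 * real n \<le> real n * real n" using n by (intro mult_right_mono) auto
    then have "3 * real n ^ 2 \<le> 4 * ((real n - 1) * (real n - 2))"
      by (simp add: power2_eq_square algebra_simps)
    then have "(\<gamma> n)\<^sup>2 * real n / 3 * (3 * real n ^ 2) \<le> (\<gamma> n)\<^sup>2 * real n / 3 * (4 * ((real n - 1) * (real n - 2)))"
      by (intro mult_left_mono) auto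
    then show ?thesis by (simp add: wedge_mean_def eval_nat_numeral mult_ac)
  qed
  have "pmf (bind_pmf (planted_model n ?g) (degree_test b n)) False \<le>
      (6 * real n ^ 3 + 48 * ?g\<^sup>2 * real n ^ 4) / ?s\<^sup>2"
  proof (rule pmf_bind_planted_model_le)
    fix T assume T: "tournament n T"
    have "1 \<le> (wedge_sum n T - wedge_mean n ?g)\<^sup>2 / ?s\<^sup>2" if "2 * wedge_sum n T < real n * real (b n)"
    proof -
      have "?s \<le> wedge_mean n ?g - wedge_sum n T" using that thr mean by linarith
      from power_mono[OF this, of 2] show ?thesis
        using pos by (simp only: le_divide_eq_1_pos zero_less_power
            power2_commute[of "wedge_sum n T"])
    qed
    then show "pmf (degree_test b n T) False \<le> (wedge_sum n T - wedge_mean n ?g)\<^sup>2 / ?s\<^sup>2"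
      by (auto simp: degree_test_wedge_sum[OF T] indicator_def not_le)
  qed (use pos \<gamma> n in auto)
  also have "\<dots> = 24 / (?g ^ 4 * real n ^ 3) + 192 / (?g * real n)\<^sup>2"
    using n \<gamma> by (simp add: field_simps eval_nat_numeral)
  finally show ?thesis using 1 by (simp add: detection_error_def)
qed

text \<open>Cutting the digits and the integer division each cost at most 1, so a lies between gamma
  n - 2 and gamma n. Once gamma n >= 4 the threshold n a^2 / 2 is between one eighth and one half of
  gamma^2 n^3.\<close>

lemma strong_detection_degree_test:
  assumes \<gamma>: "\<And>n. 0 \<le> \<gamma> n \<and> \<gamma> n \<le> 1 / 2" and \<omega>: "\<gamma> \<in> \<omega>(\<lambda>n. real n powr (- (3 / 4)))"
  shows "strong_detection \<gamma> (degree_test (\<lambda>n. (min n (n * parameter_digits \<gamma> n div 2 ^ n))\<^sup>2))"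
proof -
  define a where "a n = min n (n * parameter_digits \<gamma> n div 2 ^ n)" for n
  define g where "g n = \<gamma> n * real n powr (3 / 4)" for n
  have a_le: "real (a n) \<le> \<gamma> n * real n" for n
  proof -
    have "real (a n) \<le> real (n * parameter_digits \<gamma> n div 2 ^ n)" by (simp add: a_def)
    also have "\<dots> \<le> real (n * parameter_digits \<gamma> n) / 2 ^ n"
      using of_nat_div_le_of_nat[of "n * parameter_digits \<gamma> n" "2 ^ n", where 'a = real] by simp
    also have "\<dots> \<le> real n * (\<gamma> n * 2 ^ n) / 2 ^ n"
    proof -
      have "real (parameter_digits \<gamma> n) \<le> \<gamma> n * 2 ^ n"
        using \<gamma>[of n] by (simp add: parameter_digits_def)
      then show ?thesis
        unfolding of_nat_mult by (intro divide_right_mono mult_left_mono) auto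
    qed
    finally show ?thesis by (simp add: mult.commute)
  qed
  have a_ge: "\<gamma> n * real n - 2 \<le> real (a n)" for n
  proof -
    let ?w = "parameter_digits \<gamma> n"
    have "\<gamma> n * 2 ^ n - 1 \<le> real ?w"
      unfolding parameter_digits_def using real_nat_ceiling_ge by linarith
    then have "real n * (\<gamma> n * 2 ^ n - 1) / 2 ^ n \<le> real n * real ?w / 2 ^ n"
      by (intro divide_right_mono mult_left_mono) auto
    moreover have "real n * (\<gamma> n * 2 ^ n - 1) / 2 ^ n = \<gamma> n * real n - real n / 2 ^ n"
      by (simp add: field_simps)
    moreover have "real n / 2 ^ n \<le> 1"
      using of_nat_less_two_power[of n, where 'a = real] by simp
    moreover have "real n * real ?w / 2 ^ n - 1 \<le> real (n * ?w div 2 ^ n)"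
    proof -
      have "real (n * ?w mod 2 ^ n) \<le> real (2 ^ n)"
        unfolding of_nat_le_iff by (simp add: less_imp_le)
      then have "real (n * ?w mod 2 ^ n) / 2 ^ n \<le> 1" by simp
      then show ?thesis
        using of_nat_of_nat_div_aux[of "n * ?w" "2 ^ n", where 'a = real] by simp
    qed
    ultimately have "\<gamma> n * real n - 2 \<le> real (n * ?w div 2 ^ n)" by linarith
    \<comment> \<open>The cap at n does no harm because gamma <= 1.\<close>
    moreover have "\<gamma> n * real n - 2 \<le> real n"
    proof -
      have "\<gamma> n * real n \<le> 1 * real n" using \<gamma>[of n] by (intro mult_right_mono) auto
      then show ?thesis by simp
    qed
    ultimately show ?thesis by (simp add: a_def min_def)
  qed
  have g: "filterlim g at_top sequentially"
  proof -
    have "eventually (\<lambda>n. real n powr (- (3 / 4)) \<noteq> 0) sequentially"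
      using eventually_gt_at_top[of 0] by eventually_elim simp
    from smallomegaD_filterlim_at_top_norm[OF \<omega> this]
    have "filterlim (\<lambda>n. norm (\<gamma> n / real n powr (- (3 / 4)))) at_top sequentially" .
    moreover have "norm (\<gamma> n / real n powr (- (3 / 4))) = g n" for n
      unfolding g_def powr_minus_divide using conjunct1[OF \<gamma>, of n] by (simp add: abs_mult)
    ultimately show ?thesis by simp
  qed
  \<comment> \<open>408 = 24 * 16 + 24: replacing a by gamma n / 2 in the null error costs 2^4. The
    bound 4 on g ensures gamma n - 2 >= gamma n / 2.\<close>
  have "eventually (\<lambda>n. detection_error \<gamma> (degree_test (\<lambda>n. (a n)\<^sup>2)) n \<le> 408 / g n ^ 4 + 192 / g n ^ 2) sequentially"
    using filterlim_at_top[THEN iffD1, OF g, rule_format, of 4] eventually_ge_at_top[of 12]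
  proof eventually_elim
    case (elim n)
    have n1: "1 \<le> real n powr (1 / 4)" using elim by (simp add: ge_one_powr_ge_zero)
    have eq: "\<gamma> n * real n = g n * real n powr (1 / 4)"
      using elim by (simp add: g_def powr_add[symmetric])
    have gn: "g n \<le> \<gamma> n * real n"
      unfolding eq using n1 elim by (simp add: mult_le_cancel_left1)
    have eq4: "\<gamma> n ^ 4 * real n ^ 3 = g n ^ 4"
      using elim by (simp add: g_def power_mult_distrib powr_power powr_numeral)
    have pos: "\<gamma> n > 0"
      using elim \<gamma>[of n] by (cases "\<gamma> n = 0") (auto simp: g_def)
    have half: "\<gamma> n * real n / 2 \<le> real (a n)" using a_ge[of n] gn elim by linarith
    have a0: "real (a n) > 0" using half gn elim by linarith
    have "detection_error \<gamma> (degree_test (\<lambda>n. (a n)\<^sup>2)) n \<le>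
      24 * real n / (real ((a n)\<^sup>2))\<^sup>2 + 24 / (\<gamma> n ^ 4 * real n ^ 3) + 192 / (\<gamma> n * real n)\<^sup>2"
    proof (rule detection_error_degree_test)
      have "real n * (real (a n))\<^sup>2 \<le> real n * (\<gamma> n * real n)\<^sup>2"
        by (intro mult_left_mono power_mono a_le) auto
      then show "real n * real ((a n)\<^sup>2) \<le> (\<gamma> n)\<^sup>2 * real n ^ 3"
        by (simp add: power_mult_distrib eval_nat_numeral mult_ac)
    qed (use pos \<gamma> elim a0 in auto)
    also have "24 * real n / (real ((a n)\<^sup>2))\<^sup>2 \<le> 384 / g n ^ 4"
    proof -
      have "(\<gamma> n * real n / 2) ^ 4 \<le> real (a n) ^ 4"
        using half gn elim by (intro power_mono) auto
      moreover have "(\<gamma> n * real n / 2) ^ 4 = g n ^ 4 * real n / 16"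
        unfolding eq4[symmetric] by (simp add: power_divide power_mult_distrib eval_nat_numeral)
      ultimately have "24 * real n / real (a n) ^ 4 \<le> 24 * real n / (g n ^ 4 * real n / 16)"
        by (intro divide_left_mono mult_pos_pos divide_pos_pos zero_less_power) (use elim a0 in auto)
      then show ?thesis using elim by (simp flip: power_mult)
    qed
    also have "192 / (\<gamma> n * real n)\<^sup>2 \<le> 192 / g n ^ 2"
      using gn elim pos by (intro divide_left_mono power_mono mult_pos_pos zero_less_power) auto
    finally show ?case unfolding eq4 by (simp add: add_divide_distrib[symmetric])
  qed
  moreover have "eventually (\<lambda>n. 0 \<le> detection_error \<gamma> (degree_test (\<lambda>n. (a n)\<^sup>2)) n) sequentially"
    by (simp add: detection_error_def)
  moreover have "(\<lambda>n. 408 / g n ^ 4 + 192 / g n ^ 2) \<longlonglongrightarrow> 0 + 0"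
    by (intro tendsto_add tendsto_divide_0[OF tendsto_const] filterlim_at_top_imp_at_infinity
        filterlim_pow_at_top g) auto
  ultimately have "detection_error \<gamma> (degree_test (\<lambda>n. (a n)\<^sup>2)) \<longlonglongrightarrow> 0"
    using tendsto_sandwich[OF _ _ tendsto_const] by fastforce
  then show ?thesis by (simp add: strong_detection_def a_def)
qed

text \<open>The constant 4 gives gamma^2 n^3 >= 16 n^(3/2), enough for b = 16
  \<open>floor_sqrt n\<close>. The error budget is 3/8 + 3/32 + 1/32 = 1/2.\<close>

lemma weak_detection_degree_test:
  assumes \<gamma>: "\<And>n. 0 \<le> \<gamma> n \<and> \<gamma> n \<le> 1 / 2"
    and ge: "eventually (\<lambda>n. \<gamma> n \<ge> 4 * real n powr (- (3 / 4))) sequentially"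
  shows "weak_detection \<gamma> (degree_test (\<lambda>n. 16 * floor_sqrt n))"
proof -
  have "eventually (\<lambda>n. detection_error \<gamma> (degree_test (\<lambda>n. 16 * floor_sqrt n)) n \<le> 1 / 2) sequentially"
    \<comment> \<open>The bound on n makes the last term at most 1/32, since (gamma n)^2 >= 16 sqrt
      n >= 16 * 384.\<close>
    using ge eventually_ge_at_top[of "384\<^sup>2"]
  proof eventually_elim
    case (elim n)
    let ?r = "floor_sqrt n"
    have n: "real n > 0" using elim by simp
    have sq: "sqrt (real n) \<ge> 384" using elim real_le_rsqrt[of 384 "real n"]
      by (metis of_nat_le_iff of_nat_numeral of_nat_power)
    have r1: "?r \<ge> 1" using elim by (intro le_floor_sqrtI) auto
    have r_le: "real ?r \<le> sqrt (real n)"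
      by (intro real_le_rsqrt) (metis floor_sqrt_power2_le of_nat_le_iff of_nat_power)
    have pos: "\<gamma> n > 0" using elim n by (smt (verit) powr_gt_zero)
    have g2: "16 * sqrt (real n) \<le> (\<gamma> n)\<^sup>2 * real n ^ 2"
    proof -
      have "(4 * real n powr (- (3 / 4)))\<^sup>2 \<le> (\<gamma> n)\<^sup>2"
        using elim by (intro power_mono) auto
      then have "(4 * real n powr (- (3 / 4)))\<^sup>2 * real n ^ 2 \<le> (\<gamma> n)\<^sup>2 * real n ^ 2"
        by (rule mult_right_mono) simp
      moreover have "(4 * real n powr (- (3 / 4)))\<^sup>2 * real n ^ 2 = 16 * sqrt (real n)"
      proof -
        have "sqrt (real n) = real n powr (- (3 / 2) + 2)"
          using n by (simp add: powr_half_sqrt)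
        also have "\<dots> = real n powr (- (3 / 2)) * real n ^ 2"
          unfolding powr_add using n by (simp add: powr_numeral)
        finally show ?thesis using n by (simp add: power_mult_distrib powr_power)
      qed
      ultimately show ?thesis by simp
    qed
    have g4: "256 \<le> \<gamma> n ^ 4 * real n ^ 3"
    proof -
      have "(16 * sqrt (real n))\<^sup>2 \<le> ((\<gamma> n)\<^sup>2 * real n ^ 2)\<^sup>2"
        using g2 by (intro power_mono) auto
      then have "256 * real n \<le> \<gamma> n ^ 4 * real n ^ 3 * real n"
        by (simp add: power_mult_distrib flip: power_mult) (simp add: eval_nat_numeral mult_ac)
      then show ?thesis using n by simp
    qed
    have "detection_error \<gamma> (degree_test (\<lambda>n. 16 * floor_sqrt n)) n \<le>
      24 * real n / (real (16 * ?r))\<^sup>2 + 24 / (\<gamma> n ^ 4 * real n ^ 3) + 192 / (\<gamma> n * real n)\<^sup>2"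
    proof (rule detection_error_degree_test)
      have "real n * real (16 * ?r) \<le> real n * (16 * sqrt (real n))"
        using r_le by (intro mult_left_mono) auto
      also have "\<dots> \<le> real n * ((\<gamma> n)\<^sup>2 * real n ^ 2)"
        by (intro mult_left_mono g2) auto
      finally show "real n * real (16 * ?r) \<le> (\<gamma> n)\<^sup>2 * real n ^ 3"
        by (simp add: eval_nat_numeral mult_ac)
    qed (use pos \<gamma> elim r1 in auto)
    \<comment> \<open>Rounding the root down costs at most a factor 4 in its square, as r + 1 <= 2
      r; 24 * 4 / 256 = 3/8.\<close>
    also have "24 * real n / (real (16 * ?r))\<^sup>2 \<le> 3 / 8"
    proof -
      have "n < (Suc ?r)\<^sup>2" by (rule Suc_floor_sqrt_power2_gt)
      also have "\<dots> \<le> (2 * ?r)\<^sup>2" using r1 by (intro power_mono) auto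
      finally have "real n \<le> 4 * (real ?r)\<^sup>2"
        by (metis less_imp_le of_nat_le_iff of_nat_mult of_nat_numeral of_nat_power power_mult_distrib
            four_x_squared)
      then show ?thesis using r1 by (simp add: divide_le_eq power_mult_distrib)
    qed
    also have "24 / (\<gamma> n ^ 4 * real n ^ 3) \<le> 24 / 256"
      using g4 by (intro divide_left_mono) auto
    also have "192 / (\<gamma> n * real n)\<^sup>2 \<le> 192 / (16 * 384)"
      using g2 sq by (intro divide_left_mono) (auto simp: power_mult_distrib)
    finally show ?case by simp
  qed
  then have "limsup (\<lambda>n. ereal (detection_error \<gamma> (degree_test (\<lambda>n. 16 * floor_sqrt n)) n)) \<le> ereal (1 - 1 / 2)"
    by (intro Limsup_bounded) auto
  then show ?thesis unfolding weak_detection_def by (intro exI[of _ "1 / 2"]) auto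
qed

theorem theorem2p2:
  shows
    "(\<forall>\<gamma> :: nat \<Rightarrow> real. (\<forall>n. 0 \<le> \<gamma> n \<and> \<gamma> n \<le> 1 / 2) \<longrightarrow>
        \<gamma> \<in> \<omega>(\<lambda>n. real n powr (- (3 / 4))) \<longrightarrow>
        (\<exists>A. polynomial_time_with (parameter_digits \<gamma>) A \<and> strong_detection \<gamma> A)) \<and>
     (\<forall>\<gamma> :: nat \<Rightarrow> real. (\<forall>n. 0 \<le> \<gamma> n \<and> \<gamma> n \<le> 1 / 2) \<longrightarrow>
        \<gamma> \<in> O(\<lambda>n. real n powr (- (3 / 4))) \<longrightarrow>
        \<not> (\<exists>A. strong_detection \<gamma> A)) \<and>
     (\<exists>c::real. c > 0 \<and> (\<forall>\<gamma> :: nat \<Rightarrow> real. (\<forall>n. 0 \<le> \<gamma> n \<and> \<gamma> n \<le> 1 / 2) \<longrightarrow>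
        (\<forall>\<^sub>F n in sequentially. \<gamma> n \<ge> c * real n powr (- (3 / 4))) \<longrightarrow>
        (\<exists>A. polynomial_time A \<and> weak_detection \<gamma> A))) \<and>
     (\<forall>\<gamma> :: nat \<Rightarrow> real. (\<forall>n. 0 \<le> \<gamma> n \<and> \<gamma> n \<le> 1 / 2) \<longrightarrow>
        \<gamma> \<in> o(\<lambda>n. real n powr (- (3 / 4))) \<longrightarrow>
        \<not> (\<exists>A. weak_detection \<gamma> A))"
proof (intro conjI)
  show "\<forall>\<gamma> :: nat \<Rightarrow> real. (\<forall>n. 0 \<le> \<gamma> n \<and> \<gamma> n \<le> 1 / 2) \<longrightarrow>
      \<gamma> \<in> \<omega>(\<lambda>n. real n powr (- (3 / 4))) \<longrightarrow>
      (\<exists>A. polynomial_time_with (parameter_digits \<gamma>) A \<and> strong_detection \<gamma> A)"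
    using polynomial_time_digits strong_detection_degree_test by blast
  show "\<forall>\<gamma> :: nat \<Rightarrow> real. (\<forall>n. 0 \<le> \<gamma> n \<and> \<gamma> n \<le> 1 / 2) \<longrightarrow>
      \<gamma> \<in> O(\<lambda>n. real n powr (- (3 / 4))) \<longrightarrow> \<not> (\<exists>A. strong_detection \<gamma> A)"
    using no_strong_detection by blast
  show "\<exists>c::real. c > 0 \<and> (\<forall>\<gamma> :: nat \<Rightarrow> real. (\<forall>n. 0 \<le> \<gamma> n \<and> \<gamma> n \<le> 1 / 2) \<longrightarrow>
      (\<forall>\<^sub>F n in sequentially. \<gamma> n \<ge> c * real n powr (- (3 / 4))) \<longrightarrow>
      (\<exists>A. polynomial_time A \<and> weak_detection \<gamma> A))"
    using polynomial_time_sqrt weak_detection_degree_test by (intro exI[of _ 4]) fastforce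
  show "\<forall>\<gamma> :: nat \<Rightarrow> real. (\<forall>n. 0 \<le> \<gamma> n \<and> \<gamma> n \<le> 1 / 2) \<longrightarrow>
      \<gamma> \<in> o(\<lambda>n. real n powr (- (3 / 4))) \<longrightarrow> \<not> (\<exists>A. weak_detection \<gamma> A)"
    using no_weak_detection by blast
qed

end
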